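(* For $|q|<1$, \begin{align*} \sum_{i,j,k\geq 0}\frac{q^{4i^2+2j^2+k^2+4ij-2ik-2jk}}{(q^2;q^2)_i(q^2;q^2)_j(q^2;q^2)_k}&=\frac{J_2^3J_{5,12}}{J_1^2J_4^2}, \\ \sum_{i,j,k\geq 0} \frac{q^{2i^2+j^2+\frac{1}{2}k^2+2ij-ik-jk+\frac{1}{2}k}}{(q;q)_i(q;q)_j(q;q)_k}&=\frac{J_2^2J_3^2}{J_1^3J_{6}}, \\ \sum_{i,j,k\geq 0} \frac{q^{4i^2+2j^2+k^2+4ij-2ik-2jk+2i}}{(q^2;q^2)_i(q^2;q^2)_j(q^2;q^2)_k}&=\frac{J_2^3J_{3,12}}{J_1^2J_4^2},\\ \sum_{i,j,k\geq 0} \frac{q^{2i^2+j^2+\frac{1}{2}k^2+2ij-ik-jk+2i+j-\frac{1}{2}k}}{(q;q)_i(q;q)_j(q;q)_k}&=2\frac{J_2J_6^2}{J_1^2J_3}, \\ \sum_{i,j,k\geq 0} \frac{q^{4i^2+2j^2+k^2+4ij-2ik-2jk+4i+2j}}{(q^2;q^2)_i(q^2;q^2)_j(q^2;q^2)_k}&=\frac{J_2^3J_{1,12}}{J_1^2J_4^2}. \end{align*}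
   Context: For $|q|<1$: $(a;q)_n=\prod_{k=0}^{n-1}(1-aq^k)$ ($(a;q)_0=1$), $(a;q)_\infty=\prod_{k\ge0}(1-aq^k)$; $J_m:=(q^m;q^m)_\infty$ and $J_{a,m}:=(q^a;q^m)_\infty(q^{m-a};q^m)_\infty(q^m;q^m)_\infty$. Half-integer powers of $q$ use a fixed choice of $q^{1/2}$ (e.g. $0<q<1$). *)

theory Defs
  imports "HOL-Analysis.Analysis"
begin

definition qpoch :: "complex \<Rightarrow> complex \<Rightarrow> nat \<Rightarrow> complex" where
  "qpoch a q n = (\<Prod>k<n. 1 - a * q ^ k)"

definition qpoch_inf :: "complex \<Rightarrow> complex \<Rightarrow> complex" where
  "qpoch_inf a q = (\<Prod>k. 1 - a * q ^ k)"

definition J :: "nat \<Rightarrow> complex \<Rightarrow> complex" where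
  "J m q = qpoch_inf (q ^ m) (q ^ m)"

definition Jam :: "nat \<Rightarrow> nat \<Rightarrow> complex \<Rightarrow> complex" where
  "Jam a m q = qpoch_inf (q ^ a) (q ^ m) * qpoch_inf (q ^ (m - a)) (q ^ m) * J m q"

end

theory Submission
  imports Defs
begin

text \<open>
  Write \<open>s = i + j\<close>. Euler's identity sums each series over \<open>k\<close>. The remaining sum over \<open>s\<close> has inner sum
  \<open>\<beta>\<^sub>s = \<Sum> q\<^bsup>i\<^sup>2 + e i\<^esup> / ((q;q)\<^sub>i (q;q)\<^bsub>s-i\<^esub>)\<close>, which is the \<open>\<beta>\<close> of a Bailey pair obtained by two steps of the
  Bailey chain from a specialisation of the finite Jacobi triple product. Inserting \<open>\<alpha>\<close> and summing over \<open>s\<close>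
  by the limiting \<open>q\<close>-Gauss sum leaves a bilateral theta series, a product by Jacobi's triple product.
  The \<open>q\<close>-Gauss sum is the only series identity needed: \<open>c = 0\<close> is Euler's identity, and a
  terminating case is the \<open>q\<close>-Vandermonde sum behind the Bailey chain.
\<close>

section \<open>\<open>q\<close>-Pochhammer symbols and the \<open>q\<close>-Gauss sum\<close>

text \<open>In a suitable base \<open>p\<close> every exponent is
  \<open>(i+j)^2 + i^2 + tri k - k * (i+j)\<close> plus linear terms, which the factor
  \<open>z^k\<close> and the parameters \<open>a\<close>, \<open>e\<close> absorb. The pairs
  \<open>(p, z)\<close> are \<open>(q^2, q)\<close>, \<open>(q, q)\<close> and
  \<open>(q, 1)\<close>; no half-integer power survives, because \<open>k^2 + k\<close> and
  \<open>k^2 - k\<close> are even. The obstacle is the cross term: the sum over \<open>k\<close> is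
  \<open>(-z/p^s; p)_inf\<close>, which contains negative powers of \<open>p\<close>. Reversing its
  first \<open>s\<close> factors costs \<open>p^(s(s+1)/2)\<close>, which is paid out of
  \<open>p^(s^2)\<close>. What remains, \<open>z^s p^(s(s-1)/2) (-p/z; p)_s\<close>, is exactly a
  weight against which the q-Gauss sum evaluates the Bailey kernel. That evaluation multiplies
  \<alpha> by a quotient of Pochhammer symbols which need not be a power of \<open>p\<close>. In
  some cases it simplifies only after the terms at \<open>n\<close> and \<open>-a-n\<close> are
  added, so \<alpha> lives on all integers and only symmetrised identities are required of it. The
  argument divides by \<open>q\<close>. At \<open>q = 0\<close> each series instead counts the zeros
  of its exponent.\<close>

lemma qpoch_0 [simp]: "qpoch a q 0 = 1"
  by (simp add: qpoch_def)

lemma qpoch_Suc: "qpoch a q (Suc n) = qpoch a q n * (1 - a * q ^ n)"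
  by (simp add: qpoch_def)

lemma qpoch_add: "qpoch a q (m + n) = qpoch a q m * qpoch (a * q ^ m) q n"
  by (induction n) (simp_all add: qpoch_Suc power_add algebra_simps)

lemma qpoch_Suc_shift: "qpoch a q (Suc n) = (1 - a) * qpoch (a * q) q n"
  using qpoch_add[of a q 1 n] by (simp add: qpoch_Suc)

lemma qpoch_nonzero: "(\<And>k. a * q ^ k \<noteq> 1) \<Longrightarrow> qpoch a q n \<noteq> 0"
  by (auto simp: qpoch_def)

lemma power_ne_1:
  fixes q :: complex
  assumes "norm q < 1" "n > 0"
  shows "q ^ n \<noteq> 1"
proof
  assume "q ^ n = 1"
  hence "norm q ^ n = 1" by (metis norm_one norm_power)
  moreover have "norm q ^ n < 1"
    using assms by (simp add: power_less_one_iff)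
  ultimately show False by simp
qed

lemma power_Suc_ne_1: "norm q < 1 \<Longrightarrow> q * q ^ k \<noteq> (1::complex)"
  using power_ne_1[of q "Suc k"] by simp

lemma qpoch_qq_nonzero [simp]: "norm q < 1 \<Longrightarrow> qpoch q q n \<noteq> 0"
  by (intro qpoch_nonzero power_Suc_ne_1)

text \<open>Guarantees that no factor of \<open>(-z; q)_n\<close> vanishes. The boundary
  \<open>norm z = 1\<close> is allowed because the fourth identity takes
  \<open>z = 1\<close>.\<close>

lemma minus_mult_power_ne_1:
  fixes q z :: complex
  assumes "norm q < 1" "norm z \<le> 1" "z \<noteq> - 1"
  shows "- z * q ^ k \<noteq> 1"
proof (cases "k = 0")
  case True
  thus ?thesis using assms(3) by (metis minus_minus mult.right_neutral power_0)
next
  case False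
  have "norm (- z * q ^ k) \<le> 1 * norm q ^ k"
    using mult_right_mono[OF assms(2), of "norm q ^ k"] by (simp add: norm_mult norm_power)
  also have "\<dots> < 1" using False assms by (simp add: power_less_one_iff)
  finally show ?thesis by (metis less_irrefl norm_one)
qed

section \<open>Convergence, nonvanishing and boundedness of the infinite products\<close>

lemma convergent_prod_qpoch:
  fixes a q :: complex
  assumes "norm q < 1"
  shows "convergent_prod (\<lambda>k. 1 - a * q ^ k)"
proof -
  have "summable (\<lambda>k. norm (1 - a * q ^ k - 1))"
    using assms by (simp add: norm_mult norm_power summable_mult)
  thus ?thesis
    by (intro abs_convergent_prod_imp_convergent_prod summable_imp_abs_convergent_prod)
qed

lemma qpoch_LIMSEQ:
  assumes "norm q < 1"
  shows "qpoch a q \<longlonglongrightarrow> qpoch_inf a q"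
proof -
  have "(\<lambda>n. \<Prod>k\<le>n. 1 - a * q ^ k) \<longlonglongrightarrow> qpoch_inf a q"
    unfolding qpoch_inf_def by (rule convergent_prod_LIMSEQ[OF convergent_prod_qpoch[OF assms]])
  hence "(\<lambda>n. qpoch a q (Suc n)) \<longlonglongrightarrow> qpoch_inf a q"
    by (simp add: qpoch_def lessThan_Suc_atMost)
  thus ?thesis by (rule LIMSEQ_imp_Suc)
qed

lemma qpoch_inf_nonzero:
  assumes "norm q < 1" "\<And>k. a * q ^ k \<noteq> 1"
  shows "qpoch_inf a q \<noteq> 0"
  unfolding qpoch_inf_def
  by (rule prodinf_nonzero[OF convergent_prod_qpoch[OF assms(1)]]) (use assms(2) in auto)

lemma qpoch_inf_qq_nonzero [simp]: "norm q < 1 \<Longrightarrow> qpoch_inf q q \<noteq> 0"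
  by (intro qpoch_inf_nonzero power_Suc_ne_1)

lemma qpoch_inf_split:
  assumes "norm q < 1"
  shows "qpoch_inf a q = qpoch a q n * qpoch_inf (a * q ^ n) q"
proof (rule LIMSEQ_unique)
  show "(\<lambda>m. qpoch a q (n + m)) \<longlonglongrightarrow> qpoch_inf a q"
    using LIMSEQ_ignore_initial_segment[OF qpoch_LIMSEQ[OF assms], of a n] by (simp add: add.commute)
  show "(\<lambda>m. qpoch a q (n + m)) \<longlonglongrightarrow> qpoch a q n * qpoch_inf (a * q ^ n) q"
    unfolding qpoch_add by (intro tendsto_intros qpoch_LIMSEQ assms)
qed

lemma qpoch_bounded:
  assumes "norm q < 1"
  obtains C where "C > 0" "\<And>n. norm (qpoch a q n) \<le> C"
proof -
  have "Bseq (qpoch a q)"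
    using qpoch_LIMSEQ[OF assms] by (intro convergent_imp_Bseq convergentI)
  thus ?thesis using that by (auto simp: Bseq_def)
qed

lemma inverse_qpoch_bounded:
  assumes "norm q < 1" "\<And>k. a * q ^ k \<noteq> 1"
  obtains C where "C > 0" "\<And>n. norm (inverse (qpoch a q n)) \<le> C"
proof -
  have "(\<lambda>n. inverse (qpoch a q n)) \<longlonglongrightarrow> inverse (qpoch_inf a q)"
    by (intro tendsto_inverse qpoch_LIMSEQ qpoch_inf_nonzero assms)
  hence "Bseq (\<lambda>n. inverse (qpoch a q n))"
    by (intro convergent_imp_Bseq convergentI)
  thus ?thesis using that by (auto simp: Bseq_def)
qed

lemma zero_choose_two [simp]: "0 choose 2 = 0"
  by (simp add: numeral_2_eq_2)

lemma Suc_choose_two: "Suc m choose 2 = (m choose 2) + m"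
  by (simp add: numeral_2_eq_2)

lemma summable_power_choose_two:
  fixes r B :: real
  assumes "0 \<le> r" "r < 1" "0 \<le> B"
  shows "summable (\<lambda>m. r ^ (m choose 2) * B ^ m)"
proof -
  have "(\<lambda>m. r ^ m * B) \<longlonglongrightarrow> 0 * B"
    using assms by (intro tendsto_intros LIMSEQ_realpow_zero) auto
  hence "eventually (\<lambda>m. r ^ m * B < 1/2) sequentially"
    by (intro order_tendstoD) auto
  then obtain N where N: "\<And>m. m \<ge> N \<Longrightarrow> r ^ m * B \<le> 1/2"
    unfolding eventually_sequentially using less_imp_le by blast
  show ?thesis
  proof (rule summable_ratio_test[of "1/2" N])
    fix m assume "m \<ge> N"
    have "r ^ (Suc m choose 2) * B ^ Suc m = (r ^ m * B) * (r ^ (m choose 2) * B ^ m)"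
      by (simp add: Suc_choose_two power_add)
    also have "\<dots> \<le> 1/2 * (r ^ (m choose 2) * B ^ m)"
      using N[OF \<open>m \<ge> N\<close>] assms by (intro mult_right_mono) auto
    finally show "norm (r ^ (Suc m choose 2) * B ^ Suc m) \<le> 1/2 * norm (r ^ (m choose 2) * B ^ m)"
      using assms by simp
  qed simp
qed

lemma tannery_nat:
  fixes f :: "nat \<Rightarrow> nat \<Rightarrow> complex"
  assumes "\<And>k. (\<lambda>n. f k n) \<longlonglongrightarrow> g k" "\<And>k n. norm (f k n) \<le> M k" "summable M"
  shows "(\<lambda>n. \<Sum>k. f k n) \<longlonglongrightarrow> (\<Sum>k. g k)"
proof -
  have "eventually (\<lambda>(k, n). norm (f k n) \<le> M k) (sequentially \<times>\<^sub>F sequentially)"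
    using assms(2) by (intro always_eventually) auto
  thus ?thesis using tannerys_theorem[of f g sequentially M] assms(1,3) by simp
qed

section \<open>The limiting q-Gauss sum\<close>

context
  fixes q c :: complex
  assumes q: "norm q < 1" and c: "\<And>k. c * q ^ k \<noteq> 1"
begin

definition phi_coeff :: "nat \<Rightarrow> complex" where
  "phi_coeff m = (-1) ^ m * q ^ (m choose 2) / (qpoch q q m * qpoch c q m)"

text \<open>With \<open>c = a * x\<close> the product is \<open>x^m (a; q)_m\<close>, the shape in
  which the q-Gauss sum is usually written. Multiplied out, it is a polynomial in \<open>x\<close>,
  so the limit \<open>x -> 0\<close> below is harmless.\<close>

definition phi_term :: "complex \<Rightarrow> nat \<Rightarrow> complex" where
  "phi_term x m = phi_coeff m * (\<Prod>k<m. x - c * q ^ k)"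

lemma phi_coeff_Suc:
  "phi_coeff (Suc m) * (1 - q ^ Suc m) * (1 - c * q ^ m) = - phi_coeff m * q ^ m"
  using q c[of m] power_ne_1[OF q, of "Suc m"] qpoch_nonzero[of c q m, OF c]
  by (simp add: phi_coeff_def qpoch_Suc Suc_choose_two power_add divide_simps)

text \<open>The power \<open>q^(m choose 2)\<close> beats any geometric growth of the product.
  Uniformity on a disc is what the dominated limit along \<open>y * q^n\<close> in
  \<open>phi_sum\<close> requires.\<close>

lemma phi_term_majorant:
  obtains M where "summable M" "\<And>x m. norm x \<le> R \<Longrightarrow> norm (phi_term x m) \<le> M m"
proof -
  obtain C1 where C1: "C1 > 0" "\<And>n. norm (inverse (qpoch q q n)) \<le> C1"
    using inverse_qpoch_bounded[OF q power_Suc_ne_1[OF q]] by blast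
  obtain C2 where C2: "C2 > 0" "\<And>n. norm (inverse (qpoch c q n)) \<le> C2"
    using inverse_qpoch_bounded[OF q c] by blast
  define B where "B = \<bar>R\<bar> + norm c"
  define M where "M m = C1 * C2 * (norm q ^ (m choose 2) * B ^ m)" for m
  have "summable M" unfolding M_def
    by (intro summable_mult summable_power_choose_two) (use q in \<open>auto simp: B_def\<close>)
  moreover have "norm (phi_term x m) \<le> M m" if "norm x \<le> R" for x m
  proof -
    have "norm (\<Prod>k<m. x - c * q ^ k) \<le> (\<Prod>k<m. B)"
      unfolding prod_norm[symmetric]
    proof (intro prod_mono conjI)
      fix k
      have "norm (x - c * q ^ k) \<le> norm x + norm (c * q ^ k)" by (rule norm_triangle_ineq4)
      also have "norm (c * q ^ k) \<le> norm c * 1"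
        unfolding norm_mult norm_power using q by (intro mult_left_mono power_le_one) auto
      finally show "norm (x - c * q ^ k) \<le> B" using that by (simp add: B_def)
    qed auto
    moreover have "norm (phi_coeff m) \<le> C1 * C2 * norm q ^ (m choose 2)"
    proof -
      have "norm (phi_coeff m) = norm (inverse (qpoch q q m)) * norm (inverse (qpoch c q m)) * norm q ^ (m choose 2)"
        by (simp add: phi_coeff_def norm_divide norm_mult norm_power norm_inverse field_simps)
      also have "\<dots> \<le> C1 * C2 * norm q ^ (m choose 2)"
        using C1 C2 by (intro mult_mono) auto
      finally show ?thesis .
    qed
    ultimately have "norm (phi_term x m) \<le> (C1 * C2 * norm q ^ (m choose 2)) * (\<Prod>k<m. B)"
      unfolding phi_term_def norm_mult using C1 C2 by (intro mult_mono) auto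
    thus ?thesis by (simp add: M_def)
  qed
  ultimately show ?thesis using that by blast
qed

lemma summable_phi_term: "summable (\<lambda>m. norm (phi_term x m))"
proof -
  obtain M where M: "summable M" "\<And>y m. norm y \<le> norm x \<Longrightarrow> norm (phi_term y m) \<le> M m"
    using phi_term_majorant[of "norm x"] by blast
  have "norm (norm (phi_term x m)) \<le> M m" for m using M(2)[of x m] by simp
  with M(1) show ?thesis by (rule summable_comparison_test'[of M 0])
qed

text \<open>The difference of the two sides of \<open>f x = (1 - x) * f (q * x)\<close> telescopes termwise.\<close>

lemma phi_functional_equation:
  "(\<Sum>m. phi_term x m) = (1 - x) * (\<Sum>m. phi_term (q * x) m)"
proof -
  define u where "u m = (\<Prod>k<m. x - c * q ^ k)" for m
  have u_shift: "(\<Prod>k<Suc m. q * x - c * q ^ k) = q ^ m * (q * x - c) * u m" for m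
  proof -
    have "(\<Prod>k<Suc m. q * x - c * q ^ k) = (q * x - c) * (\<Prod>k<m. q * x - c * q ^ Suc k)"
      by (subst prod.lessThan_Suc_shift) simp
    also have "(\<Prod>k<m. q * x - c * q ^ Suc k) = (\<Prod>k<m. q * (x - c * q ^ k))"
      by (intro prod.cong) (auto simp: algebra_simps)
    also have "\<dots> = q ^ m * u m" by (simp add: prod.distrib u_def)
    finally show ?thesis by simp
  qed
  define d where "d m = phi_term x m - (1 - x) * phi_term (q * x) m" for m
  have partial: "(\<Sum>k<Suc m. d k) = x * q ^ m * phi_term x m" for m
  proof (induction m)
    case 0
    show ?case by (simp add: d_def phi_term_def phi_coeff_def)
  next
    case (Suc m)
    have "d (Suc m) = phi_coeff (Suc m) * u m * ((x - c * q ^ m) - (1 - x) * q ^ m * (q * x - c))"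
      unfolding d_def phi_term_def u_shift by (simp add: u_def algebra_simps)
    \<comment> \<open>The split isolates the factor \<open>(1 - q^(m+1)) * (1 - c * q^m)\<close>,
      which \<open>phi_coeff_Suc\<close> trades for the previous coefficient.\<close>
    also have "\<dots> = x * q ^ Suc m * (phi_coeff (Suc m) * u m * (x - c * q ^ m))
                      + x * u m * (phi_coeff (Suc m) * (1 - q ^ Suc m) * (1 - c * q ^ m))"
      by (simp add: algebra_simps)
    also have "\<dots> = x * q ^ Suc m * phi_term x (Suc m) - x * q ^ m * phi_term x m"
      unfolding phi_coeff_Suc by (simp add: phi_term_def u_def algebra_simps)
    finally show ?case using Suc.IH by simp
  qed
  have "d sums ((\<Sum>m. phi_term x m) - (1 - x) * (\<Sum>m. phi_term (q * x) m))"
    unfolding d_def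
    by (intro sums_diff sums_mult summable_sums summable_norm_cancel[OF summable_phi_term])
  hence "(\<lambda>m. \<Sum>k<Suc m. d k) \<longlonglongrightarrow> (\<Sum>m. phi_term x m) - (1 - x) * (\<Sum>m. phi_term (q * x) m)"
    unfolding sums_def by (rule LIMSEQ_Suc)
  moreover have "(\<lambda>m. x * q ^ m * phi_term x m) \<longlonglongrightarrow> x * 0 * 0"
    by (intro tendsto_intros LIMSEQ_power_zero q
        summable_LIMSEQ_zero[OF summable_norm_cancel[OF summable_phi_term]])
  ultimately show ?thesis
    unfolding partial using LIMSEQ_unique by fastforce
qed

text \<open>Iterating the functional equation pushes the argument to 0 and gives
  \<open>f y = (y; q)_inf * f 0\<close>. The constant \<open>f 0\<close> is found at
  \<open>y = c\<close>, where the factor \<open>k = 0\<close> of the product kills every term except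
  the first.\<close>

lemma phi_sum: "(\<Sum>m. phi_term x m) = qpoch_inf x q / qpoch_inf c q"
proof -
  define f where "f y = (\<Sum>m. phi_term y m)" for y
  have iterate: "f y = qpoch y q n * f (y * q ^ n)" for y n
  proof (induction n)
    case (Suc n)
    have "f (y * q ^ n) = (1 - y * q ^ n) * f (y * q ^ Suc n)"
      using phi_functional_equation[of "y * q ^ n"] by (simp add: f_def mult_ac)
    thus ?case using Suc by (simp add: qpoch_Suc)
  qed simp
  have f: "f y = qpoch_inf y q * f 0" for y
  proof -
    obtain M where M: "summable M" "\<And>x m. norm x \<le> norm y \<Longrightarrow> norm (phi_term x m) \<le> M m"
      using phi_term_majorant[of "norm y"] by blast
    have "(\<lambda>n. phi_term (y * q ^ n) m) \<longlonglongrightarrow> phi_term (y * 0) m" for m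
      unfolding phi_term_def by (intro tendsto_intros LIMSEQ_power_zero q)
    moreover have "norm (y * q ^ n) \<le> norm y" for n
      using q by (simp add: norm_mult norm_power mult_left_le power_le_one)
    ultimately have "(\<lambda>n. f (y * q ^ n)) \<longlonglongrightarrow> f 0"
      unfolding f_def using M by (intro tannery_nat[of _ _ M]) auto
    hence "(\<lambda>n. qpoch y q n * f (y * q ^ n)) \<longlonglongrightarrow> qpoch_inf y q * f 0"
      by (intro tendsto_mult qpoch_LIMSEQ q)
    thus ?thesis by (simp flip: iterate add: LIMSEQ_const_iff)
  qed
  have "phi_term c m = (if m = 0 then 1 else 0)" for m
    by (cases m) (simp_all add: phi_term_def phi_coeff_def numeral_2_eq_2 prod.lessThan_Suc_shift del: prod.lessThan_Suc)
  hence "f c = 1" using sums_single[of 0 "\<lambda>_. 1::complex"] by (simp add: f_def sums_iff)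
  hence "qpoch_inf c q * f 0 = 1" using f[of c] by simp
  moreover from this have "qpoch_inf c q \<noteq> 0" by auto
  ultimately have "f 0 = 1 / qpoch_inf c q" by (simp add: field_simps)
  thus ?thesis using f[of x] by (simp add: f_def)
qed

end

text \<open>The \<open>b \<rightarrow> \<infinity>\<close> case of the \<open>q\<close>-Gauss sum, written so that it includes \<open>c = 0\<close> and \<open>x = 0\<close>.\<close>

lemma phi_has_sum:
  fixes q c x :: complex
  assumes "norm q < 1" "\<And>k. c * q ^ k \<noteq> 1"
  shows "((\<lambda>m. (-1) ^ m * q ^ (m choose 2) * (\<Prod>k<m. x - c * q ^ k) / (qpoch q q m * qpoch c q m))
           has_sum (qpoch_inf x q / qpoch_inf c q)) UNIV"
proof -
  have "(phi_term q c x has_sum (qpoch_inf x q / qpoch_inf c q)) UNIV"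
    using summable_phi_term[OF assms, of x]
    by (intro norm_summable_imp_has_sum) (simp_all add: sums_iff phi_sum[OF assms] summable_norm_cancel)
  thus ?thesis by (simp add: phi_term_def[OF assms, abs_def] phi_coeff_def[OF assms])
qed

section \<open>Finite identities and the Bailey chain\<close>

text \<open>Each factor \<open>1 - y/q^j\<close> equals \<open>(-y/q^j) * (1 - q^j/y)\<close>; the
  powers of \<open>q\<close> collect to the triangular number \<open>Suc t choose 2\<close>.\<close>

lemma qpoch_reverse:
  assumes "q \<noteq> 0" "y \<noteq> 0"
  shows "qpoch (y / q ^ t) q t * q ^ (Suc t choose 2) = (- y) ^ t * qpoch (q / y) q t"
proof (induction t)
  case 0
  show ?case by (simp add: Suc_choose_two)
next
  case (Suc t)
  have "y / q ^ Suc t * q = y / q ^ t" using assms by simp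
  hence "qpoch (y / q ^ Suc t) q (Suc t) * q ^ (Suc (Suc t) choose 2) =
        (1 - y / q ^ Suc t) * q ^ Suc t * (qpoch (y / q ^ t) q t * q ^ (Suc t choose 2))"
    by (subst qpoch_Suc_shift, subst Suc_choose_two) (simp add: power_add mult_ac)
  also have "(1 - y / q ^ Suc t) * q ^ Suc t = (- y) * (1 - q / y * q ^ t)"
    using assms by (simp add: field_simps)
  also have "qpoch (y / q ^ t) q t * q ^ (Suc t choose 2) = (- y) ^ t * qpoch (q / y) q t"
    by (rule Suc.IH)
  finally show ?case by (simp add: qpoch_Suc mult_ac)
qed

section \<open>Reciprocal Pochhammer symbols on the integers and the finite q-binomial
  theorem\<close>

definition inv_qpoch :: "complex \<Rightarrow> int \<Rightarrow> complex" where
  "inv_qpoch q n = (if n < 0 then 0 else 1 / qpoch q q (nat n))"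

lemma inv_qpoch_nonneg [simp]: "inv_qpoch q (int n) = 1 / qpoch q q n"
  by (simp add: inv_qpoch_def)

lemma inv_qpoch_neg: "n < 0 \<Longrightarrow> inv_qpoch q n = 0"
  by (simp add: inv_qpoch_def)

text \<open>Setting the reciprocal to 0 at negative indices is the value this recurrence forces at
  \<open>n = 0\<close>, so Pascal's rule below has no boundary cases.\<close>

lemma inv_qpoch_pred:
  assumes "norm q < 1"
  shows "inv_qpoch q (int n - 1) = (1 - q ^ n) * inv_qpoch q (int n)"
proof (cases n)
  case (Suc m)
  have "inv_qpoch q (int n - 1) = inv_qpoch q (int m)" by (simp add: Suc)
  moreover have "inv_qpoch q (int n) = 1 / qpoch q q (Suc m)" unfolding Suc by (rule inv_qpoch_nonneg)
  ultimately show ?thesis using power_ne_1[OF assms, of "Suc m"] assms by (simp add: Suc qpoch_Suc)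
qed (simp add: inv_qpoch_neg)

text \<open>Induction by q-Pascal: the two neighbours of a coefficient contribute the same sum, once
  plainly and once with the factor \<open>- x * q^N\<close>, which together form the new factor of
  \<open>qpoch x q\<close>.\<close>

lemma q_binomial_theorem:
  fixes q x :: complex
  assumes q: "norm q < 1"
  shows "(\<Sum>k\<le>N. (-1) ^ k * q ^ (k choose 2) * x ^ k * (inv_qpoch q (int k) * inv_qpoch q (int N - int k)))
           = qpoch x q N / qpoch q q N"
proof (induction N)
  case (Suc N)
  define c where "c k = (-1) ^ k * q ^ (k choose 2) * x ^ k" for k
  define b where "b N k = inv_qpoch q (int k) * inv_qpoch q (int N - int k)" for N k
  have pascal0: "(1 - q ^ Suc N) * b (Suc N) 0 = b N 0"
    using inv_qpoch_pred[OF q, of "Suc N"] by (simp add: b_def)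
  have pascal: "(1 - q ^ Suc N) * b (Suc N) (Suc k) = b N (Suc k) + q ^ (N - k) * b N k"
    if "k \<le> N" for k
  proof -
    have 1: "b N (Suc k) = (1 - q ^ (N - k)) * b (Suc N) (Suc k)"
      using inv_qpoch_pred[OF q, of "N - k"] that unfolding b_def
      by (simp add: of_nat_diff diff_diff_eq add.commute)
    have 2: "b N k = (1 - q ^ Suc k) * b (Suc N) (Suc k)"
      using inv_qpoch_pred[OF q, of "Suc k"] unfolding b_def by (simp add: mult_ac)
    have "q ^ (N - k) * q ^ Suc k = q ^ Suc N"
      using that by (simp flip: power_add)
    hence "(1 - q ^ (N - k)) + q ^ (N - k) * (1 - q ^ Suc k) = 1 - q ^ Suc N"
      by (simp add: right_diff_distrib del: power_Suc)
    thus ?thesis unfolding 1 2 by (metis distrib_right mult.assoc)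
  qed
  have c_Suc: "c (Suc k) = - x * q ^ k * c k" for k
    by (simp add: c_def Suc_choose_two power_add)
  have "(1 - q ^ Suc N) * (\<Sum>k\<le>Suc N. c k * b (Suc N) k)
        = c 0 * ((1 - q ^ Suc N) * b (Suc N) 0) + (\<Sum>k\<le>N. c (Suc k) * ((1 - q ^ Suc N) * b (Suc N) (Suc k)))"
    unfolding sum.atMost_Suc_shift distrib_left sum_distrib_left by (simp add: mult_ac)
  also have "(\<Sum>k\<le>N. c (Suc k) * ((1 - q ^ Suc N) * b (Suc N) (Suc k)))
        = (\<Sum>k\<le>N. c (Suc k) * b N (Suc k)) + (\<Sum>k\<le>N. - x * q ^ N * (c k * b N k))"
    unfolding sum.distrib[symmetric]
  proof (intro sum.cong refl)
    fix k assume k: "k \<in> {..N}"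
    hence "q ^ k * q ^ (N - k) = q ^ N" by (simp flip: power_add)
    hence "c (Suc k) * (q ^ (N - k) * b N k) = - x * q ^ N * (c k * b N k)"
      unfolding c_Suc by (metis (no_types, opaque_lifting) mult.assoc mult.left_commute)
    thus "c (Suc k) * ((1 - q ^ Suc N) * b (Suc N) (Suc k)) =
        c (Suc k) * b N (Suc k) + - x * q ^ N * (c k * b N k)"
      using k by (simp add: pascal distrib_left del: power_Suc)
  qed
  also have "c 0 * ((1 - q ^ Suc N) * b (Suc N) 0) + ((\<Sum>k\<le>N. c (Suc k) * b N (Suc k)) + (\<Sum>k\<le>N. - x * q ^ N * (c k * b N k)))
      = (\<Sum>k\<le>Suc N. c k * b N k) - x * q ^ N * (\<Sum>k\<le>N. c k * b N k)"
    unfolding pascal0 sum.atMost_Suc_shift sum_distrib_left by (simp add: sum_negf)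
  \<comment> \<open>The extra term \<open>k = N + 1\<close> contains \<open>inv_qpoch\<close> at
    -1.\<close>
  also have "(\<Sum>k\<le>Suc N. c k * b N k) = (\<Sum>k\<le>N. c k * b N k)"
    by (simp add: b_def inv_qpoch_neg)
  finally have "(1 - q ^ Suc N) * (\<Sum>k\<le>Suc N. c k * b (Suc N) k) = (1 - x * q ^ N) * (\<Sum>k\<le>N. c k * b N k)"
    by (simp add: algebra_simps)
  also have "(\<Sum>k\<le>N. c k * b N k) = qpoch x q N / qpoch q q N"
    using Suc.IH by (simp add: c_def b_def)
  finally have "(\<Sum>k\<le>Suc N. c k * b (Suc N) k) = qpoch x q (Suc N) / qpoch q q (Suc N)"
    using power_ne_1[OF q, of "Suc N"] q
    by (simp add: qpoch_Suc field_simps del: sum.atMost_Suc)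
  thus ?case unfolding c_def b_def .
qed (simp add: inv_qpoch_def)

section \<open>The Bailey kernel, the finite triple product and the Bailey chain\<close>

definition tri :: "int \<Rightarrow> int" where
  "tri n = n * (n - 1) div 2"

lemma two_tri: "2 * tri n = n * (n - 1)"
  unfolding tri_def by (rule dvd_mult_div_cancel) simp

lemma tri_of_nat: "tri (int m) = int (m choose 2)"
  by (cases m) (simp_all add: tri_def choose_two zdiv_int algebra_simps)

lemma tri_add: "tri (m + n) = tri m + tri n + m * n"
  using two_tri[of "m + n"] two_tri[of m] two_tri[of n] by (simp add: algebra_simps)

lemma tri_minus: "tri (- n) = tri n + n"
  using two_tri[of "- n"] two_tri[of n] by (simp add: algebra_simps)

text \<open>The usual kernel relative to \<open>q^a\<close> has \<open>(q^(a+1); q)_(s+n)\<close> in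
  its denominator. Using \<open>(q; q)_(s+n+a)\<close> changes it only by the constant
  \<open>(q; q)_a\<close>, and makes the two factors trade places under
  \<open>n -> -a-n\<close>.\<close>

definition bailey_kernel :: "complex \<Rightarrow> nat \<Rightarrow> nat \<Rightarrow> int \<Rightarrow> complex" where
  "bailey_kernel q a s n = inv_qpoch q (int s - n) * inv_qpoch q (int s + n + int a)"

lemma bailey_kernel_reflect: "bailey_kernel q a s (- int a - n) = bailey_kernel q a s n"
  by (simp add: bailey_kernel_def algebra_simps)

lemma bailey_kernel_outside: "n \<notin> {- int (s + a)..int s} \<Longrightarrow> bailey_kernel q a s n = 0"
  by (auto simp: bailey_kernel_def inv_qpoch_def)

text \<open>The q-binomial theorem of order \<open>2s + a\<close> at the argument
  \<open>y/q^(s+a)\<close>, with the summation index recentred; \<open>qpoch_reverse\<close> then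
  removes the negative powers.\<close>

lemma finite_jacobi:
  assumes q: "norm q < 1" "q \<noteq> 0" and y: "y \<noteq> 0"
  shows "(\<Sum>n = - int (s + a)..int s. (-1) powi n * y powi n * q powi (tri n) * bailey_kernel q a s n)
           = qpoch y q s * qpoch (q / y) q (s + a) / qpoch q q (2 * s + a)"
proof -
  define t where "t = s + a"
  define N where "N = t + s"
  define g where "g n = (-1) powi n * y powi n * q powi (tri n) * bailey_kernel q a s n" for n
  \<comment> \<open>The cross term \<open>- t * k\<close> produced by \<open>tri\<close> is what
    turns \<open>y\<close> into \<open>y / q^t\<close>.\<close>
  have g: "g (int k - int t) = (-1) ^ t / y ^ t * q ^ (Suc t choose 2) *
       ((-1) ^ k * q ^ (k choose 2) * (y / q ^ t) ^ k * (inv_qpoch q (int k) * inv_qpoch q (int N - int k)))" for k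
  proof -
    have "tri (int k - int t) = int (k choose 2) + int (Suc t choose 2) - int t * int k"
      using tri_add[of "int k" "- int t"] tri_minus[of "int t"]
      by (simp add: tri_of_nat Suc_choose_two)
    hence "q powi tri (int k - int t) = q ^ (k choose 2) * q ^ (Suc t choose 2) / (q ^ t) ^ k"
      using q by (simp add: power_int_diff power_int_add flip: power_mult)
         (metis of_nat_mult power_int_of_nat)
    moreover have "(-1) powi (int k - int t) = (-1) ^ k * ((-1) ^ t :: complex)"
      by (simp add: power_int_diff minus_one_power_iff)
    moreover have "y powi (int k - int t) = y ^ k / y ^ t"
      using y by (simp add: power_int_diff)
    moreover have "bailey_kernel q a s (int k - int t) = inv_qpoch q (int k) * inv_qpoch q (int N - int k)"
      by (simp add: bailey_kernel_def N_def t_def algebra_simps)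
    ultimately show ?thesis by (simp add: g_def power_divide mult_ac)
  qed
  have "(\<Sum>n = - int (s + a)..int s. g n) = (\<Sum>k\<le>N. g (int k - int t))"
    by (rule sum.reindex_bij_witness[of _ "\<lambda>k. int k - int t" "\<lambda>n. nat (n + int t)"])
       (auto simp: t_def N_def)
  also have "\<dots> = (-1) ^ t / y ^ t * q ^ (Suc t choose 2) * (qpoch (y / q ^ t) q N / qpoch q q N)"
    unfolding g sum_distrib_left[symmetric] q_binomial_theorem[OF q(1)] ..
  also have "qpoch (y / q ^ t) q N = qpoch (y / q ^ t) q t * qpoch y q s"
    unfolding N_def qpoch_add using q by simp
  also have "(-1) ^ t / y ^ t * q ^ (Suc t choose 2) * (qpoch (y / q ^ t) q t * qpoch y q s / qpoch q q N)
     = (-1) ^ t / y ^ t * (qpoch (y / q ^ t) q t * q ^ (Suc t choose 2)) * qpoch y q s / qpoch q q N"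
    by simp
  also have "\<dots> = qpoch y q s * qpoch (q / y) q t / qpoch q q N"
    unfolding qpoch_reverse[OF q(2) y] using y by (simp add: power_minus[of y])
  moreover have "N = 2 * s + a" by (simp add: N_def t_def)
  ultimately show ?thesis by (simp add: g_def t_def)
qed

text \<open>The q-Gauss sum at \<open>c = q^(N+1)\<close>, \<open>x = c * q^M\<close> terminates,
  and its infinite products reduce to \<open>1 / (c; q)_M\<close>. The form with all factors
  \<open>(q; q)\<close> in denominators fits the Bailey kernel.\<close>

lemma q_vandermonde:
  assumes q: "norm q < 1"
  shows "(\<Sum>m\<le>M. q ^ (m\<^sup>2 + m * N) / (qpoch q q (M - m) * qpoch q q m * qpoch q q (m + N)))
           = 1 / (qpoch q q M * qpoch q q (M + N))"
proof -
  define c where "c = q ^ Suc N"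
  have c: "c * q ^ k \<noteq> 1" for k
    using power_ne_1[OF q, of "Suc (N + k)"] by (simp add: c_def power_add mult_ac)
  have c_poch: "qpoch c q m = qpoch q q (m + N) / qpoch q q N" for m
    using qpoch_add[of q q N m] q by (simp add: c_def add.commute field_simps)
  define f where "f m = (-1) ^ m * q ^ (m choose 2) * (\<Prod>k<m. c * q ^ M - c * q ^ k) / (qpoch q q m * qpoch c q m)" for m
  have "(f has_sum (qpoch_inf (c * q ^ M) q / qpoch_inf c q)) UNIV"
    unfolding f_def by (rule phi_has_sum[OF q c])
  also have "qpoch_inf (c * q ^ M) q / qpoch_inf c q = 1 / qpoch c q M"
    using qpoch_inf_split[OF q, of c M] qpoch_inf_nonzero[OF q c] by simp
  finally have "(f has_sum (1 / qpoch c q M)) UNIV" .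
  \<comment> \<open>For \<open>m > M\<close> the factor \<open>k = M\<close> of the product is
    zero.\<close>
  moreover have "(f has_sum (\<Sum>m\<le>M. f m)) UNIV"
    by (rule has_sum_finite_neutralI) (auto simp: f_def)
  ultimately have "(\<Sum>m\<le>M. f m) = 1 / qpoch c q M"
    using has_sum_unique by blast
  moreover have "f m = qpoch q q M * qpoch q q N *
      (q ^ (m\<^sup>2 + m * N) / (qpoch q q (M - m) * qpoch q q m * qpoch q q (m + N)))" if "m \<le> M" for m
  proof -
    have "(\<Prod>k<m. c * q ^ M - c * q ^ k) * qpoch q q (M - m) = c ^ m * (-1) ^ m * q ^ (m choose 2) * qpoch q q M"
      using that
    proof (induction m)
      case (Suc m)
      have "qpoch q q (M - m) = qpoch q q (M - Suc m) * (1 - q ^ (M - m))"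
        using Suc.prems qpoch_Suc[of q q "M - Suc m"] by (simp add: Suc_diff_Suc flip: power_Suc)
      moreover have "c * q ^ M - c * q ^ m = - c * q ^ m * (1 - q ^ (M - m))"
      proof -
        have "q ^ M = q ^ m * q ^ (M - m)" using Suc.prems by (simp flip: power_add)
        thus ?thesis by (simp add: algebra_simps)
      qed
      ultimately have "(\<Prod>k<Suc m. c * q ^ M - c * q ^ k) * qpoch q q (M - Suc m)
            = - c * q ^ m * ((\<Prod>k<m. c * q ^ M - c * q ^ k) * qpoch q q (M - m))"
        by (simp add: mult_ac)
      also have "(\<Prod>k<m. c * q ^ M - c * q ^ k) * qpoch q q (M - m) = c ^ m * (-1) ^ m * q ^ (m choose 2) * qpoch q q M"
        using Suc by simp
      finally show ?case by (simp add: Suc_choose_two power_add mult_ac)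
    qed simp
    hence prod: "(\<Prod>k<m. c * q ^ M - c * q ^ k) = c ^ m * (-1) ^ m * q ^ (m choose 2) * qpoch q q M / qpoch q q (M - m)"
      using q by (simp add: field_simps)
    \<comment> \<open>One \<open>m choose 2\<close> stands in the series, the other comes from
      pulling \<open>- q^k\<close> out of \<open>q^M - q^k\<close>, and \<open>c^m\<close> supplies
      \<open>(N + 1) * m\<close>.\<close>
    have "(m choose 2) + (m choose 2) + Suc N * m = m\<^sup>2 + m * N"
      by (induction m) (auto simp: Suc_choose_two power2_eq_square)
    hence "q ^ (m choose 2) * q ^ (m choose 2) * c ^ m = q ^ (m\<^sup>2 + m * N)"
      unfolding c_def by (metis power_add power_mult)
    moreover have "(-1) ^ m * (-1) ^ m = (1::complex)" by (simp flip: power_mult_distrib)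
    ultimately show ?thesis
      using q unfolding f_def prod c_poch by (simp add: field_simps)
  qed
  ultimately have "qpoch q q M * qpoch q q N * (\<Sum>m\<le>M. q ^ (m\<^sup>2 + m * N) / (qpoch q q (M - m) * qpoch q q m * qpoch q q (m + N)))
      = 1 / qpoch c q M"
    by (simp add: sum_distrib_left)
  thus ?thesis using q by (simp add: c_poch field_simps)
qed

text \<open>The chain operator acts diagonally on the kernels: with \<open>s = n + m\<close> the
  exponent splits off \<open>n^2 + a * n\<close>, and the rest is \<open>q_vandermonde\<close> with
  \<open>N = 2n + a\<close>. Negative \<open>n\<close> follows by reflection.\<close>

lemma bailey_kernel_chain:
  assumes q: "norm q < 1" "q \<noteq> 0" and a: "a \<le> 1"
  shows "(\<Sum>s\<le>L. q ^ (s\<^sup>2 + a * s) / qpoch q q (L - s) * bailey_kernel q a s n) = q powi (n\<^sup>2 + int a * n) * bailey_kernel q a L n"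
proof -
  have *: "(\<Sum>s\<le>L. q ^ (s\<^sup>2 + a * s) / qpoch q q (L - s) * bailey_kernel q a s (int n)) = q powi ((int n)\<^sup>2 + int a * int n) * bailey_kernel q a L (int n)" for n
  proof (cases "n \<le> L")
    case False
    thus ?thesis by (simp add: bailey_kernel_outside)
  next
    case True
    define M where "M = L - n"
    have L: "L = n + M" using True by (simp add: M_def)
    have "(\<Sum>s\<le>L. q ^ (s\<^sup>2 + a * s) / qpoch q q (L - s) * bailey_kernel q a s (int n))
        = (\<Sum>s\<in>{n..L}. q ^ (s\<^sup>2 + a * s) / qpoch q q (L - s) * bailey_kernel q a s (int n))"
      by (rule sum.mono_neutral_right) (auto simp: bailey_kernel_outside)
    also have "\<dots> = (\<Sum>m\<le>M. q ^ ((n + m)\<^sup>2 + a * (n + m)) / qpoch q q (M - m) * bailey_kernel q a (n + m) (int n))"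
      by (rule sum.reindex_bij_witness[of _ "\<lambda>m. n + m" "\<lambda>s. s - n"]) (auto simp: L add.commute)
    also have "\<dots> = (\<Sum>m\<le>M. q ^ (n\<^sup>2 + a * n) * (q ^ (m\<^sup>2 + m * (2 * n + a)) / (qpoch q q (M - m) * qpoch q q m * qpoch q q (m + (2 * n + a)))))"
    proof (intro sum.cong refl)
      fix m
      have "bailey_kernel q a (n + m) (int n) = inv_qpoch q (int m) * inv_qpoch q (int (m + (2 * n + a)))"
        by (simp add: bailey_kernel_def algebra_simps)
      moreover have "(n + m)\<^sup>2 + a * (n + m) = (n\<^sup>2 + a * n) + (m\<^sup>2 + m * (2 * n + a))"
        by (simp add: power2_eq_square algebra_simps)
      ultimately show "q ^ ((n + m)\<^sup>2 + a * (n + m)) / qpoch q q (M - m) * bailey_kernel q a (n + m) (int n) =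
         q ^ (n\<^sup>2 + a * n) * (q ^ (m\<^sup>2 + m * (2 * n + a)) / (qpoch q q (M - m) * qpoch q q m * qpoch q q (m + (2 * n + a))))"
        by (simp add: power_add del: of_nat_add)
    qed
    also have "\<dots> = q ^ (n\<^sup>2 + a * n) * (1 / (qpoch q q M * qpoch q q (M + (2 * n + a))))"
      unfolding sum_distrib_left[symmetric] q_vandermonde[OF q(1)] ..
    also have "1 / (qpoch q q M * qpoch q q (M + (2 * n + a))) = bailey_kernel q a L (int n)"
    proof -
      have "bailey_kernel q a L (int n) = inv_qpoch q (int M) * inv_qpoch q (int (M + (2 * n + a)))"
        by (simp add: bailey_kernel_def L algebra_simps)
      thus ?thesis by (simp del: of_nat_add)
    qed
    also have "q ^ (n\<^sup>2 + a * n) = q powi ((int n)\<^sup>2 + int a * int n)"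
      by (simp flip: power_int_of_nat)
    finally show ?thesis .
  qed
  show ?thesis
  proof (cases "n \<ge> 0")
    case True
    thus ?thesis using *[of "nat n"] by simp
  next
    case False
    \<comment> \<open>For \<open>n < 0\<close> the bound \<open>a \<le> 1\<close> makes the
      reflected index nonnegative; with \<open>a = 2\<close> the index -1 would be its own
      reflection.\<close>
    define m where "m = - int a - n"
    have m: "m \<ge> 0" using False a by (simp add: m_def)
    have n: "n = - int a - m" by (simp add: m_def)
    have "n\<^sup>2 + int a * n = m\<^sup>2 + int a * m"
      by (simp add: m_def power2_eq_square algebra_simps)
    moreover have "bailey_kernel q a s n = bailey_kernel q a s m" for s
      unfolding n by (rule bailey_kernel_reflect)
    ultimately show ?thesis using *[of "nat m"] m by simp
  qed
qed

text \<open>Bailey pairs relative to \<open>q\<^sup>a\<close>, with the two halves of the usual \<open>\<alpha>\<close> spread over all integers.\<close>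

definition bailey_pair :: "complex \<Rightarrow> nat \<Rightarrow> (int \<Rightarrow> complex) \<Rightarrow> (nat \<Rightarrow> complex) \<Rightarrow> bool" where
  "bailey_pair q a \<alpha> \<beta> \<longleftrightarrow> (\<forall>L. \<beta> L = (\<Sum>n = - int (L + a)..int L. \<alpha> n * bailey_kernel q a L n))"

text \<open>Bailey's lemma with both free parameters sent to infinity; it is linear in \<alpha>, so
  the diagonal action on kernels suffices.\<close>

lemma bailey_pair_chain:
  assumes q: "norm q < 1" "q \<noteq> 0" and a: "a \<le> 1" and B: "bailey_pair q a \<alpha> \<beta>"
  shows "bailey_pair q a (\<lambda>n. q powi (n\<^sup>2 + int a * n) * \<alpha> n)
           (\<lambda>L. \<Sum>s\<le>L. q ^ (s\<^sup>2 + a * s) / qpoch q q (L - s) * \<beta> s)"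
  unfolding bailey_pair_def
proof
  fix L
  have "(\<Sum>s\<le>L. q ^ (s\<^sup>2 + a * s) / qpoch q q (L - s) * \<beta> s)
      = (\<Sum>s\<le>L. \<Sum>n = - int (L + a)..int L. \<alpha> n * (q ^ (s\<^sup>2 + a * s) / qpoch q q (L - s) * bailey_kernel q a s n))"
  proof (intro sum.cong refl)
    fix s assume "s \<in> {..L}"
    \<comment> \<open>The range is widened from \<open>s\<close> to \<open>L\<close>, where the
      kernel vanishes, so that the two sums can be swapped as a rectangle.\<close>
    hence "\<beta> s = (\<Sum>n = - int (L + a)..int L. \<alpha> n * bailey_kernel q a s n)"
      using B unfolding bailey_pair_def
      by (auto intro!: sum.mono_neutral_left simp: bailey_kernel_outside)
    thus "q ^ (s\<^sup>2 + a * s) / qpoch q q (L - s) * \<beta> s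
        = (\<Sum>n = - int (L + a)..int L. \<alpha> n * (q ^ (s\<^sup>2 + a * s) / qpoch q q (L - s) * bailey_kernel q a s n))"
      by (simp add: sum_distrib_left mult_ac)
  qed
  also have "\<dots> = (\<Sum>n = - int (L + a)..int L. \<alpha> n * (\<Sum>s\<le>L. q ^ (s\<^sup>2 + a * s) / qpoch q q (L - s) * bailey_kernel q a s n))"
    by (subst sum.swap) (simp add: sum_distrib_left)
  also have "\<dots> = (\<Sum>n = - int (L + a)..int L. q powi (n\<^sup>2 + int a * n) * \<alpha> n * bailey_kernel q a L n)"
    unfolding bailey_kernel_chain[OF q a] by (simp add: mult_ac)
  finally show "(\<Sum>s\<le>L. q ^ (s\<^sup>2 + a * s) / qpoch q q (L - s) * \<beta> s) = \<dots>" .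
qed

section \<open>Jacobi's triple product\<close>

lemma has_sum_int:
  fixes f :: "int \<Rightarrow> 'a :: topological_comm_monoid_add"
  assumes "((\<lambda>k. f (int k)) has_sum A) UNIV" "((\<lambda>k. f (- 1 - int k)) has_sum B) UNIV"
  shows "(f has_sum (A + B)) UNIV"
proof -
  have "((\<lambda>k. f (int k)) has_sum A) UNIV \<longleftrightarrow> (f has_sum A) {0..}"
    by (rule has_sum_reindex_bij_witness[of _ nat int]) auto
  moreover have "((\<lambda>k. f (- 1 - int k)) has_sum B) UNIV \<longleftrightarrow> (f has_sum B) {..<0}"
    by (rule has_sum_reindex_bij_witness[of _ "\<lambda>n. nat (- 1 - n)" "\<lambda>k. - 1 - int k"]) auto
  ultimately have "(f has_sum (A + B)) ({0..} \<union> {..<0})"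
    using assms by (intro has_sum_Un_disjoint) auto
  moreover have "{0..} \<union> {..<0} = (UNIV :: int set)" by auto
  ultimately show ?thesis by simp
qed

lemma norm_le_imp_has_sum:
  fixes f :: "nat \<Rightarrow> complex"
  assumes "\<And>k. norm (f k) \<le> M k" "summable M"
  shows "(f has_sum (\<Sum>k. f k)) UNIV"
proof -
  have "summable (\<lambda>k. norm (f k))"
    by (rule summable_comparison_test'[OF assms(2), of 0]) (simp add: assms(1))
  thus ?thesis by (intro norm_summable_imp_has_sum summable_sums) (auto intro: summable_norm_cancel)
qed

lemma inv_qpoch_bounded:
  assumes "norm q < 1"
  obtains C where "C > 0" "\<And>n. norm (inv_qpoch q n) \<le> C"
proof -
  obtain C where C: "C > 0" "\<And>n. norm (inverse (qpoch q q n)) \<le> C"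
    using inverse_qpoch_bounded[OF assms power_Suc_ne_1[OF assms]] by blast
  have "norm (inv_qpoch q n) \<le> C" for n
    using C by (auto simp: inv_qpoch_def inverse_eq_divide less_imp_le)
  thus ?thesis using that C by blast
qed

lemma bailey_kernel_bounded:
  assumes "norm q < 1"
  obtains C where "C > 0" "\<And>a s n. norm (bailey_kernel q a s n) \<le> C"
proof -
  obtain C where C: "C > 0" "\<And>n. norm (inv_qpoch q n) \<le> C" using inv_qpoch_bounded[OF assms] by blast
  have "norm (bailey_kernel q a s n) \<le> C * C" for a s n
    unfolding bailey_kernel_def norm_mult using C by (intro mult_mono) auto
  thus ?thesis using that[of "C * C"] C by simp
qed

lemma inv_qpoch_LIMSEQ:
  assumes "norm q < 1"
  shows "(\<lambda>L. inv_qpoch q (int L + n)) \<longlonglongrightarrow> 1 / qpoch_inf q q"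
proof -
  have "filterlim (\<lambda>L. nat (int L + n)) at_top sequentially"
    unfolding filterlim_at_top
  proof
    fix Z
    show "eventually (\<lambda>L. Z \<le> nat (int L + n)) sequentially"
      using eventually_ge_at_top[of "nat (int Z - n)"] by eventually_elim auto
  qed
  hence "(\<lambda>L. 1 / qpoch q q (nat (int L + n))) \<longlonglongrightarrow> 1 / qpoch_inf q q"
    by (intro tendsto_divide tendsto_const filterlim_compose[OF qpoch_LIMSEQ] qpoch_inf_qq_nonzero assms)
  moreover have "eventually (\<lambda>L. 1 / qpoch q q (nat (int L + n)) = inv_qpoch q (int L + n)) sequentially"
    using eventually_ge_at_top[of "nat (- n)"] by eventually_elim (auto simp: inv_qpoch_def)
  ultimately show ?thesis by (rule Lim_transform_eventually)
qed

lemma bailey_kernel_LIMSEQ: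
  assumes "norm q < 1"
  shows "(\<lambda>L. bailey_kernel q 0 L n) \<longlonglongrightarrow> 1 / qpoch_inf q q ^ 2"
proof -
  have "(\<lambda>L. inv_qpoch q (int L + - n) * inv_qpoch q (int L + n)) \<longlonglongrightarrow> 1 / qpoch_inf q q * (1 / qpoch_inf q q)"
    by (intro tendsto_mult inv_qpoch_LIMSEQ assms)
  thus ?thesis by (simp add: bailey_kernel_def power2_eq_square)
qed

text \<open>The limit of \<open>finite_jacobi\<close> with \<open>a = 0\<close>: each kernel tends
  to \<open>1 / (q; q)_inf^2\<close> and all kernels share one bound, so Tannery's theorem applies
  to each half of the bilateral series.\<close>

theorem jacobi_triple_product:
  fixes q y :: complex
  assumes q: "norm q < 1" "q \<noteq> 0" and y: "y \<noteq> 0"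
  shows "((\<lambda>n. (-1) powi n * y powi n * q powi (tri n)) has_sum
            (qpoch_inf y q * qpoch_inf (q / y) q * qpoch_inf q q)) UNIV"
proof -
  define u where "u n = (-1) powi n * y powi n * q powi (tri n)" for n
  define M1 where "M1 k = norm q ^ (k choose 2) * norm y ^ k" for k
  \<comment> \<open>Since \<open>tri (-1-k) = (k choose 2) + 2k + 1\<close>, a term of the negative
    half has size \<open>norm (q/y)\<close> times this quadratic-geometric majorant.\<close>
  define M2 where "M2 k = norm (q / y) * (norm q ^ (k choose 2) * norm (q ^ 2 / y) ^ k)" for k
  have M: "summable M1" "summable M2"
    unfolding M1_def M2_def using q by (intro summable_mult summable_power_choose_two; simp)+
  have u1: "norm (u (int k)) \<le> M1 k" for k
    by (simp add: u_def M1_def norm_mult norm_power tri_of_nat)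
  have u2: "norm (u (- 1 - int k)) \<le> M2 k" for k
  proof -
    have "tri (- 1 - int k) = int ((k choose 2) + 2 * k + 1)"
      using two_tri[of "- 1 - int k"] two_tri[of "int k"]
      by (simp add: tri_of_nat algebra_simps)
    hence "norm (q powi tri (- 1 - int k)) = norm q ^ ((k choose 2) + 2 * k + 1)"
      by (metis norm_power power_int_of_nat)
    moreover have "y powi (- 1 - int k) = 1 / y ^ Suc k"
      using y by (simp add: power_int_diff power_int_minus field_simps)
    moreover have "norm ((-1) powi (- 1 - int k) :: complex) = 1"
      by (simp add: norm_power_int)
    ultimately show ?thesis
      by (simp add: u_def M2_def norm_mult norm_divide norm_power power_add power_mult power_divide)
  qed
  obtain C where C: "C > 0" "\<And>a s n. norm (bailey_kernel q a s n) \<le> C" using bailey_kernel_bounded[OF q(1)] by blast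
  define P where "P L = (\<Sum>k. u (int k) * bailey_kernel q 0 L (int k))" for L
  define N where "N L = (\<Sum>k. u (- 1 - int k) * bailey_kernel q 0 L (- 1 - int k))" for L
  have bound: "norm (u n * bailey_kernel q 0 L n) \<le> b * C" if "norm (u n) \<le> b" for n L b
    unfolding norm_mult using that C by (intro mult_mono) (auto intro: order.trans[OF norm_ge_zero])
  have P: "P \<longlonglongrightarrow> (\<Sum>k. u (int k) * (1 / qpoch_inf q q ^ 2))"
    unfolding P_def
    by (rule tannery_nat[of _ _ "\<lambda>k. M1 k * C"])
       (intro tendsto_mult tendsto_const bailey_kernel_LIMSEQ q bound u1 summable_mult2 M)+
  have N: "N \<longlonglongrightarrow> (\<Sum>k. u (- 1 - int k) * (1 / qpoch_inf q q ^ 2))"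
    unfolding N_def
    by (rule tannery_nat[of _ _ "\<lambda>k. M2 k * C"])
       (intro tendsto_mult tendsto_const bailey_kernel_LIMSEQ q bound u2 summable_mult2 M)+
  have PN: "P L + N L = qpoch y q L * qpoch (q / y) q L / qpoch q q (2 * L)" for L
  proof -
    have "((\<lambda>n. u n * bailey_kernel q 0 L n) has_sum (P L + N L)) UNIV"
      unfolding P_def N_def
      by (intro has_sum_int norm_le_imp_has_sum[OF bound[OF u1]] norm_le_imp_has_sum[OF bound[OF u2]]
          summable_mult2 M)
    moreover have "((\<lambda>n. u n * bailey_kernel q 0 L n) has_sum (\<Sum>n = - int (L + 0)..int L. u n * bailey_kernel q 0 L n)) UNIV"
      by (rule has_sum_finite_neutralI[of "{- int (L + 0)..int L}"]) (auto simp: bailey_kernel_outside)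
    ultimately have "P L + N L = (\<Sum>n = - int (L + 0)..int L. u n * bailey_kernel q 0 L n)"
      by (rule has_sum_unique)
    thus ?thesis using finite_jacobi[OF q y, where s = L and a = 0] by (simp add: u_def)
  qed
  have "(\<lambda>L. P L + N L) \<longlonglongrightarrow> qpoch_inf y q * qpoch_inf (q / y) q / qpoch_inf q q"
    unfolding PN using q
    by (intro tendsto_intros qpoch_LIMSEQ filterlim_compose[OF qpoch_LIMSEQ]
        filterlim_subseq) (auto simp: strict_mono_def)
  with tendsto_add[OF P N] have "(\<Sum>k. u (int k) * (1 / qpoch_inf q q ^ 2)) + (\<Sum>k. u (- 1 - int k) * (1 / qpoch_inf q q ^ 2))
      = qpoch_inf y q * qpoch_inf (q / y) q / qpoch_inf q q"
    by (rule LIMSEQ_unique)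
  moreover have s1: "((\<lambda>k. u (int k)) has_sum (\<Sum>k. u (int k))) UNIV"
    and s2: "((\<lambda>k. u (- 1 - int k)) has_sum (\<Sum>k. u (- 1 - int k))) UNIV"
    using norm_le_imp_has_sum[OF u1 M(1)] norm_le_imp_has_sum[OF u2 M(2)] .
  ultimately have "((\<Sum>k. u (int k)) + (\<Sum>k. u (- 1 - int k))) / qpoch_inf q q ^ 2
      = qpoch_inf y q * qpoch_inf (q / y) q / qpoch_inf q q"
    using has_sum_imp_sums[OF s1] has_sum_imp_sums[OF s2]
    by (simp add: sums_iff suminf_divide add_divide_distrib)
  hence "(\<Sum>k. u (int k)) + (\<Sum>k. u (- 1 - int k)) = qpoch_inf y q * qpoch_inf (q / y) q * qpoch_inf q q"
    using q by (subst (asm) nonzero_divide_eq_eq) (simp_all add: power2_eq_square)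
  with has_sum_int[OF s1 s2] show ?thesis by (simp add: u_def)
qed

section \<open>The limit of a Bailey pair\<close>

lemma abs_summable_on_prod:
  fixes f :: "'a \<Rightarrow> real" and g :: "'b \<Rightarrow> real"
  assumes "(\<lambda>x. norm (f x)) summable_on A" "(\<lambda>x. norm (g x)) summable_on B"
  shows "(\<lambda>p. norm (case p of (x, y) \<Rightarrow> f x * g y)) summable_on A \<times> B"
proof -
  have "(\<lambda>y. norm (f x * g y)) summable_on B" for x
    using summable_on_cmult_right[OF assms(2), of "norm (f x)"] by (simp add: abs_mult)
  moreover have "norm (infsum (\<lambda>y. norm (f x * g y)) B) = norm (f x) * \<bar>infsum (\<lambda>y. norm (g y)) B\<bar>" for x
    by (simp add: abs_mult infsum_cmult_right')
  hence "(\<lambda>x. norm (infsum (\<lambda>y. norm (f x * g y)) B)) summable_on A"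
    using summable_on_cmult_left[OF assms(1), of "\<bar>infsum (\<lambda>y. norm (g y)) B\<bar>"] by (simp only:)
  ultimately show ?thesis by (subst Infinite_Sum.abs_summable_on_Sigma_iff) simp
qed

lemma abs_summable_power:
  fixes r :: real
  assumes "0 \<le> r" "r < 1"
  shows "(\<lambda>k. norm (r ^ k)) summable_on (UNIV :: nat set)"
  using assms by (intro norm_summable_imp_summable_on) simp

lemma abs_summable_power_int_abs:
  fixes r :: real
  assumes "0 \<le> r" "r < 1"
  shows "(\<lambda>n. norm (r ^ nat \<bar>n\<bar>)) summable_on (UNIV :: int set)"
proof -
  have 1: "((\<lambda>k::nat. r ^ k) has_sum (\<Sum>\<^sub>\<infinity>k. r ^ k)) UNIV"
    using abs_summable_summable[OF abs_summable_power[OF assms]] by simp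
  have "((\<lambda>n::int. r ^ nat \<bar>n\<bar>) has_sum ((\<Sum>\<^sub>\<infinity>k. r ^ k) + r * (\<Sum>\<^sub>\<infinity>k. r ^ k))) UNIV"
  proof (rule has_sum_int)
    show "((\<lambda>k. r ^ nat \<bar>int k\<bar>) has_sum (\<Sum>\<^sub>\<infinity>k. r ^ k)) UNIV" using 1 by simp
    have "nat \<bar>- 1 - int k\<bar> = Suc k" for k by simp
    thus "((\<lambda>k. r ^ nat \<bar>- 1 - int k\<bar>) has_sum r * (\<Sum>\<^sub>\<infinity>k. r ^ k)) UNIV"
      using has_sum_cmult_right[OF 1, of r] by simp
  qed
  hence "(\<lambda>n::int. r ^ nat \<bar>n\<bar>) summable_on UNIV" by (rule has_sum_imp_summable)
  thus ?thesis using assms by simp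
qed

lemma summable_on_norm_le:
  fixes f :: "'a \<Rightarrow> complex" and g :: "'a \<Rightarrow> real"
  assumes "(\<lambda>x. norm (g x)) summable_on A" "\<And>x. x \<in> A \<Longrightarrow> norm (f x) \<le> C * norm (g x)"
  shows "f summable_on A"
proof -
  have "(\<lambda>x. norm (C * g x)) summable_on A"
    using summable_on_cmult_right[OF assms(1), of "\<bar>C\<bar>"] by (simp add: abs_mult)
  moreover have "norm (f x) \<le> norm (C * g x)" if "x \<in> A" for x
  proof -
    have "C * norm (g x) \<le> \<bar>C\<bar> * norm (g x)" by (intro mult_right_mono) auto
    with assms(2)[OF that] show ?thesis by (simp add: abs_mult)
  qed
  ultimately have "(\<lambda>x. norm (f x)) summable_on A"
    by (rule Infinite_Sum.abs_summable_on_comparison_test)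
  thus ?thesis by (rule abs_summable_summable)
qed

text \<open>The geometric bound gives absolute summability, so \<open>k\<close> may be summed first
  and the pairs regrouped along \<open>i + j = s\<close>. Since \<open>g\<close> depends on
  \<open>i + j\<close> only, it leaves the finite inner sum.\<close>

lemma triple_has_sum:
  fixes f :: "nat \<times> nat \<times> nat \<Rightarrow> complex"
  assumes r: "0 \<le> r" "r < 1" and bound: "\<And>i j k. norm (f (i, j, k)) \<le> C * r ^ (i + j + k)"
    and inner: "\<And>i j. ((\<lambda>k. f (i, j, k)) has_sum (g (i + j) * h i j)) UNIV"
    and outer: "((\<lambda>s. g s * (\<Sum>i\<le>s. h i (s - i))) has_sum V) UNIV"
  shows "(f has_sum V) UNIV"
proof -
  note P = abs_summable_power[OF r]
  have "f summable_on UNIV \<times> (UNIV \<times> UNIV)"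
  proof (rule summable_on_norm_le[OF abs_summable_on_prod[OF P abs_summable_on_prod[OF P P]], of _ C])
    fix p :: "nat \<times> nat \<times> nat"
    obtain i j k where "p = (i, j, k)" by (cases p)
    thus "norm (f p) \<le> C * norm (case p of (x, y) \<Rightarrow> r ^ x * (case y of (x, y) \<Rightarrow> r ^ x * r ^ y))"
      using bound[of i j k] r by (simp add: power_add mult_ac)
  qed
  then obtain S where S: "(f has_sum S) (UNIV \<times> (UNIV \<times> UNIV))"
    by (auto simp: summable_on_def)
  have "((\<lambda>((i, j), k). f (i, j, k)) has_sum S) ((UNIV \<times> UNIV) \<times> UNIV)"
    by (rule iffD1[OF has_sum_reindex_bij_witness[of _ "\<lambda>((i, j), k). (i, j, k)" "\<lambda>(i, j, k). ((i, j), k)"] S]) auto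
  hence "((\<lambda>(i, j). g (i + j) * h i j) has_sum S) (UNIV \<times> UNIV)"
    by (rule has_sum_SigmaD) (use inner in auto)
  hence "((\<lambda>(s, i). g s * h i (s - i)) has_sum S) (SIGMA s:UNIV. {..s})"
    by (rule iffD1[OF has_sum_reindex_bij_witness[of _ "\<lambda>(s, i). (i, s - i)" "\<lambda>(i, j). (i + j, i)"], rotated -1]) auto
  hence "((\<lambda>s. g s * (\<Sum>i\<le>s. h i (s - i))) has_sum S) UNIV"
    by (rule has_sum_SigmaD) (auto simp: sum_distrib_left intro!: has_sum_finiteI)
  hence "S = V" using outer by (rule has_sum_unique)
  thus ?thesis using S by simp
qed

lemma choose_two_add: "(m + n) choose 2 = (m choose 2) + (n choose 2) + m * n"
  by (induction n) (simp_all add: Suc_choose_two)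

text \<open>The conjugate Bailey pair of the weight \<open>c\<close>: only \<open>s \<ge> n\<close>
  contributes, and \<open>s = n + m\<close> makes the series a q-Gauss sum.\<close>

lemma bailey_kernel_has_sum:
  fixes q z :: complex and a n :: nat
  assumes q: "norm q < 1" and z: "z \<noteq> 0" and nz: "\<And>k. - z * q ^ k \<noteq> 1"
  defines "c \<equiv> \<lambda>s. z ^ s * q ^ ((s choose 2) + a * s) * qpoch (- q / z) q s"
  shows "((\<lambda>s. c s * bailey_kernel q a s (int n)) has_sum
           (qpoch_inf (- z) q / qpoch_inf q q * (c n / qpoch (- z) q (n + a)))) UNIV"
proof -
  \<comment> \<open>\<open>d\<close> comes from splitting \<open>(q; q)_(2n+a+m)\<close> after
    \<open>2n + a\<close> factors. \<open>x\<close> is then fixed by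
    \<open>d/x = - q^(n+1)/z\<close>, so that the product yields the remaining factors of
    \<open>(-q/z; q)_(n+m)\<close>.\<close>
  define d where "d = q ^ Suc (2 * n + a)"
  define x where "x = - z * q ^ (n + a)"
  have d: "d * q ^ k \<noteq> 1" for k
    using power_ne_1[OF q, of "Suc (2 * n + a + k)"] by (simp add: d_def power_add mult_ac)
  have prod: "(\<Prod>k<m. x - d * q ^ k) = x ^ m * qpoch (- q / z * q ^ n) q m" for m
  proof -
    have "x - d * q ^ k = x * (1 - (- q / z * q ^ n) * q ^ k)" for k
      using z by (simp add: x_def d_def power_add field_simps power_mult power2_eq_square power_mult_distrib)
    thus ?thesis by (simp add: prod.distrib qpoch_def)
  qed
  have "((\<lambda>m. c n / qpoch q q (2 * n + a) * ((-1) ^ m * q ^ (m choose 2) * (\<Prod>k<m. x - d * q ^ k) / (qpoch q q m * qpoch d q m)))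
          has_sum (c n / qpoch q q (2 * n + a) * (qpoch_inf x q / qpoch_inf d q))) UNIV"
    by (intro has_sum_cmult_right phi_has_sum q d)
  also have "c n / qpoch q q (2 * n + a) * (qpoch_inf x q / qpoch_inf d q)
      = qpoch_inf (- z) q / qpoch_inf q q * (c n / qpoch (- z) q (n + a))"
  proof -
    have "qpoch_inf q q = qpoch q q (2 * n + a) * qpoch_inf d q"
      using qpoch_inf_split[OF q, of q "2 * n + a"] by (simp add: d_def)
    moreover have "qpoch_inf (- z) q = qpoch (- z) q (n + a) * qpoch_inf x q"
      using qpoch_inf_split[OF q, of "- z" "n + a"] by (simp add: x_def)
    moreover have "qpoch (- z) q (n + a) \<noteq> 0" by (rule qpoch_nonzero) (rule nz)
    ultimately show ?thesis by (simp add: field_simps)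
  qed
  also have "(\<lambda>m. c n / qpoch q q (2 * n + a) * ((-1) ^ m * q ^ (m choose 2) * (\<Prod>k<m. x - d * q ^ k) / (qpoch q q m * qpoch d q m)))
      = (\<lambda>m. c (n + m) * bailey_kernel q a (n + m) (int n))"
  proof
    fix m
    have "bailey_kernel q a (n + m) (int n) = inv_qpoch q (int m) * inv_qpoch q (int (2 * n + a + m))"
      by (simp add: bailey_kernel_def algebra_simps)
    hence "bailey_kernel q a (n + m) (int n) = 1 / (qpoch q q m * (qpoch q q (2 * n + a) * qpoch d q m))"
      by (simp add: qpoch_add[of q q "2 * n + a" m] d_def del: of_nat_add)
    moreover have "c (n + m) = c n * ((-1) ^ m * q ^ (m choose 2) * (\<Prod>k<m. x - d * q ^ k))"
    proof -
      have "(-1) ^ m * x ^ m = z ^ m * q ^ ((n + a) * m)"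
        by (simp add: x_def power_mult_distrib power_mult flip: power_mult_distrib)
      moreover have "q ^ ((n + m choose 2) + a * (n + m)) = q ^ ((n choose 2) + a * n) * q ^ (m choose 2) * q ^ ((n + a) * m)"
        by (simp add: choose_two_add flip: power_add) (simp add: algebra_simps)
      ultimately show ?thesis
        unfolding c_def prod qpoch_add[of _ _ n m] by (simp add: power_add mult_ac)
    qed
    ultimately show "c n / qpoch q q (2 * n + a) * ((-1) ^ m * q ^ (m choose 2) * (\<Prod>k<m. x - d * q ^ k) / (qpoch q q m * qpoch d q m))
       = c (n + m) * bailey_kernel q a (n + m) (int n)"
      by (simp add: mult_ac)
  qed
  also have "((\<lambda>m. c (n + m) * bailey_kernel q a (n + m) (int n)) has_sum (qpoch_inf (- z) q / qpoch_inf q q * (c n / qpoch (- z) q (n + a)))) UNIV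
     \<longleftrightarrow> ((\<lambda>s. c s * bailey_kernel q a s (int n)) has_sum (qpoch_inf (- z) q / qpoch_inf q q * (c n / qpoch (- z) q (n + a)))) {n..}"
    by (rule has_sum_reindex_bij_witness[of _ "\<lambda>s. s - n" "\<lambda>m. n + m"]) auto
  also have "\<dots> \<longleftrightarrow> ((\<lambda>s. c s * bailey_kernel q a s (int n)) has_sum (qpoch_inf (- z) q / qpoch_inf q q * (c n / qpoch (- z) q (n + a)))) UNIV"
    by (rule has_sum_cong_neutral) (auto simp: bailey_kernel_outside)
  finally show ?thesis .
qed

text \<open>Since the kernel is invariant under \<open>n \<mapsto> - a - n\<close>, only the symmetrisation of \<open>\<alpha>\<close> matters
  in the limit of a Bailey pair.\<close>

lemma bailey_pair_limit:
  fixes q z :: complex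
  assumes q: "norm q < 1" and z: "z \<noteq> 0" and nz: "\<And>k. - z * q ^ k \<noteq> 1" and a: "a \<le> 1"
    and B: "bailey_pair q a \<alpha> \<beta>"
    and r: "0 \<le> r" "r < 1" "norm (z * q ^ a) \<le> r"
    and \<alpha>: "\<And>n. norm (\<alpha> n) \<le> r ^ nat \<bar>n\<bar>"
    and \<gamma>: "\<And>n. (\<alpha> (int n) + \<alpha> (- int a - int n)) *
                 (z ^ n * q ^ ((n choose 2) + a * n) * qpoch (- q / z) q n / qpoch (- z) q (n + a))
               = \<gamma> (int n) + \<gamma> (- int a - int n)"
    and V: "(\<gamma> has_sum V) UNIV"
  shows "((\<lambda>s. z ^ s * q ^ ((s choose 2) + a * s) * qpoch (- q / z) q s * \<beta> s)
           has_sum (qpoch_inf (- z) q / qpoch_inf q q * V)) UNIV"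
proof -
  define c where "c s = z ^ s * q ^ ((s choose 2) + a * s) * qpoch (- q / z) q s" for s
  define w where "w n = c n / qpoch (- z) q (n + a)" for n
  define K where "K = qpoch_inf (- z) q / qpoch_inf q q"
  \<comment> \<open>The q-Gauss evaluation covers \<open>n \<ge> 0\<close> only; negative indices
    inherit their value by reflection.\<close>
  define W where "W n = K * w (nat (if n \<ge> 0 then n else - int a - n))" for n
  have refl: "((\<lambda>n. f (- int a - n)) has_sum x) UNIV \<longleftrightarrow> (f has_sum x) UNIV" for f :: "int \<Rightarrow> complex" and x
    by (rule has_sum_reindex_bij_witness[of _ "\<lambda>n. - int a - n" "\<lambda>n. - int a - n"]) auto
  have W_nonneg: "((\<lambda>s. c s * bailey_kernel q a s (int n)) has_sum W (int n)) UNIV" for n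
    using bailey_kernel_has_sum[OF q z nz, where a = a and n = n] by (simp add: W_def w_def K_def c_def)
  have W_refl: "W (- int a - n) = W n" for n
    using a by (cases "a = 0") (auto simp: W_def)
  have W: "((\<lambda>s. c s * bailey_kernel q a s n) has_sum W n) UNIV" for n
  proof (cases "n \<ge> 0")
    case True
    thus ?thesis using W_nonneg[of "nat n"] by simp
  next
    case False
    hence "((\<lambda>s. c s * bailey_kernel q a s (- int a - n)) has_sum W (- int a - n)) UNIV"
      using W_nonneg[of "nat (- int a - n)"] a by simp
    thus ?thesis by (simp only: W_refl bailey_kernel_reflect)
  qed
  obtain C1 where C1: "C1 > 0" "\<And>a s n. norm (bailey_kernel q a s n) \<le> C1" using bailey_kernel_bounded[OF q] by blast
  obtain C2 where C2: "C2 > 0" "\<And>n. norm (qpoch (- q / z) q n) \<le> C2"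
    using qpoch_bounded[OF q] by blast
  have c: "norm (c s) \<le> C2 * r ^ s" for s
  proof -
    have "norm (c s) = norm q ^ (s choose 2) * norm (z * q ^ a) ^ s * norm (qpoch (- q / z) q s)"
      by (simp add: c_def norm_mult norm_power power_add power_mult power_mult_distrib)
    also have "\<dots> \<le> 1 * r ^ s * C2"
      using q C2 r by (intro mult_mono power_mono power_le_one) auto
    finally show ?thesis by (simp add: mult_ac)
  qed
  have "(\<lambda>(s, n). c s * (\<alpha> n * bailey_kernel q a s n)) summable_on UNIV \<times> UNIV"
  proof (rule summable_on_norm_le[OF abs_summable_on_prod[OF abs_summable_power abs_summable_power_int_abs, OF r(1,2) r(1,2)], of _ "C1 * C2"])
    fix p :: "nat \<times> int"
    obtain s n where p: "p = (s, n)" by (cases p)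
    have "norm (c s * (\<alpha> n * bailey_kernel q a s n)) \<le> (C2 * r ^ s) * (r ^ nat \<bar>n\<bar> * C1)"
      unfolding norm_mult using C1 C2 r by (intro mult_mono c \<alpha>) auto
    thus "norm (case p of (s, n) \<Rightarrow> c s * (\<alpha> n * bailey_kernel q a s n)) \<le> C1 * C2 * norm (case p of (x, y) \<Rightarrow> r ^ x * r ^ nat \<bar>y\<bar>)"
      using r by (simp add: p mult_ac)
  qed
  then obtain S where S: "((\<lambda>(s, n). c s * (\<alpha> n * bailey_kernel q a s n)) has_sum S) (UNIV \<times> UNIV)"
    by (auto simp: summable_on_def)
  have left: "((\<lambda>s. c s * \<beta> s) has_sum S) UNIV"
  proof (rule has_sum_SigmaD[OF S])
    fix s
    have "((\<lambda>n. \<alpha> n * bailey_kernel q a s n) has_sum \<beta> s) UNIV"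
      by (rule has_sum_finite_neutralI[of "{- int (s + a)..int s}"])
         (use B in \<open>auto simp: bailey_kernel_outside bailey_pair_def\<close>)
    thus "((\<lambda>n. case (s, n) of (s, n) \<Rightarrow> c s * (\<alpha> n * bailey_kernel q a s n)) has_sum c s * \<beta> s) UNIV"
      by (auto intro: has_sum_cmult_right)
  qed
  have right: "((\<lambda>n. \<alpha> n * W n) has_sum S) UNIV"
  proof (rule has_sum_SigmaD)
    show "((\<lambda>(n, s). c s * (\<alpha> n * bailey_kernel q a s n)) has_sum S) (UNIV \<times> UNIV)"
      using S by (subst has_sum_swap) simp
    show "((\<lambda>s. case (n, s) of (n, s) \<Rightarrow> c s * (\<alpha> n * bailey_kernel q a s n)) has_sum \<alpha> n * W n) UNIV" for n
      using has_sum_cmult_right[OF W, of "\<alpha> n" n] by (simp add: mult_ac)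
  qed
  \<comment> \<open>Adding the series to its own reflection gives twice the sum. This avoids
    choosing one index from each reflected pair, where \<open>n = 0\<close> would be special for
    \<open>a = 0\<close>.\<close>
  have "((\<lambda>n. \<alpha> n * W n + \<alpha> (- int a - n) * W (- int a - n)) has_sum (S + S)) UNIV"
    by (intro has_sum_add right iffD2[OF refl])
  moreover have "\<alpha> n * W n + \<alpha> (- int a - n) * W (- int a - n) = K * (\<gamma> n + \<gamma> (- int a - n))" for n
  proof -
    have nonneg: "(\<alpha> n + \<alpha> (- int a - n)) * W n = K * (\<gamma> n + \<gamma> (- int a - n))" if "n \<ge> 0" for n
    proof -
      have "(\<alpha> n + \<alpha> (- int a - n)) * w (nat n) = \<gamma> n + \<gamma> (- int a - n)"
        using \<gamma>[of "nat n"] that by (simp add: w_def c_def)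
      thus ?thesis using that by (simp add: W_def mult_ac)
    qed
    show ?thesis
    proof (cases "n \<ge> 0")
      case True
      thus ?thesis using nonneg[of n] by (simp add: W_refl distrib_right)
    next
      case False
      hence "- int a - n \<ge> 0" using a by simp
      from nonneg[OF this] show ?thesis by (simp add: W_refl distrib_right add.commute)
    qed
  qed
  ultimately have "((\<lambda>n. K * (\<gamma> n + \<gamma> (- int a - n))) has_sum (S + S)) UNIV" by simp
  moreover have "((\<lambda>n. K * (\<gamma> n + \<gamma> (- int a - n))) has_sum (K * (V + V))) UNIV"
    by (intro has_sum_cmult_right has_sum_add V iffD2[OF refl])
  ultimately have "S + S = K * (V + V)" by (rule has_sum_unique)
  hence "S = K * V" by (simp add: algebra_simps)
  thus ?thesis using left by (simp add: c_def K_def)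
qed

section \<open>The Bailey pairs and the triple sum\<close>

lemma norm_minus_one_powi [simp]: "norm ((-1) powi n :: complex) = 1"
  by (simp add: norm_power_int)

text \<open>The finite triple product at \<open>y = 1\<close>, where \<open>(1; q)_L\<close>
  vanishes for \<open>L > 0\<close>. A chain step applied to this \<beta> keeps only the term
  \<open>s = 0\<close>.\<close>

lemma bailey_pair_unit:
  assumes q: "norm q < 1" "q \<noteq> 0"
  shows "bailey_pair q a (\<lambda>n. (-1) powi n * q powi (tri n)) (\<lambda>L. if L = 0 then 1 else 0)"
proof -
  have "(\<Sum>n = - int (L + a)..int L. (-1) powi n * q powi (tri n) * bailey_kernel q a L n) = (if L = 0 then 1 else 0)" for L
    using finite_jacobi[OF q, of 1 a L] q by (cases L) (simp_all add: qpoch_Suc_shift)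
  thus ?thesis by (simp add: bailey_pair_def)
qed

lemma bailey_pair_chain_unit:
  assumes q: "norm q < 1" "q \<noteq> 0" and a: "a \<le> 1"
  shows "bailey_pair q a (\<lambda>n. q powi (n\<^sup>2 + int a * n) * ((-1) powi n * q powi (tri n))) (\<lambda>L. 1 / qpoch q q L)"
  using bailey_pair_chain[OF q a bailey_pair_unit[OF q]] by (simp add: if_distrib cong: if_cong)

text \<open>Supplies a linear term in \<open>i\<close> without one in \<open>i + j\<close>, as the
  third identity needs. At \<open>y = 1/q\<close> the factor \<open>1 - (1/q) * q\<close> kills all
  \<open>L \<ge> 2\<close>, so the seed has two nonzero values, and one chain step gives
  \<open>1/(q; q)_L - 1/(q; q)_(L-1)\<close> for \<open>L > 0\<close>.\<close>

lemma bailey_pair_chain_unit_shifted: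
  assumes q: "norm q < 1" "q \<noteq> 0"
  shows "bailey_pair q 0 (\<lambda>n. q powi n\<^sup>2 * ((-1) powi n * q powi (tri n - n))) (\<lambda>L. q ^ L / qpoch q q L)"
proof -
  define \<beta> where "\<beta> L = (if L = 0 then 1 else if L = 1 then - 1 / q else 0)" for L :: nat
  have "(\<Sum>n = - int (L + 0)..int L. (-1) powi n * q powi (tri n - n) * bailey_kernel q 0 L n) = \<beta> L" for L
  proof -
    have "(\<Sum>n = - int (L + 0)..int L. (-1) powi n * q powi (tri n - n) * bailey_kernel q 0 L n)
        = qpoch (1 / q) q L * qpoch (q / (1 / q)) q (L + 0) / qpoch q q (2 * L + 0)"
      by (subst finite_jacobi[OF q, symmetric])
         (use q in \<open>simp_all add: power_int_diff power_int_divide_distrib mult_ac\<close>)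
    also have "\<dots> = \<beta> L"
    proof (cases "L \<le> 1")
      case True
      then consider "L = 0" | "L = 1" by linarith
      thus ?thesis
      proof cases
        case 2
        have nz: "1 - q \<noteq> 0" "1 - q * q \<noteq> 0"
          using power_ne_1[OF q(1), of 1] power_ne_1[OF q(1), of 2] by (auto simp: power2_eq_square)
        have "1 - 1 / q = (1 - q) * (- 1 / q)" using q by (simp add: field_simps)
        hence "(1 - 1 / q) * (1 - q * q) = ((1 - q) * (1 - q * q)) * (- 1 / q)" by (simp only: mult_ac)
        hence "(1 - 1 / q) * (1 - q * q) / ((1 - q) * (1 - q * q)) = - 1 / q"
          using nz by (metis nonzero_mult_div_cancel_left mult_eq_0_iff)
        thus ?thesis using 2 by (simp add: \<beta>_def qpoch_def numeral_2_eq_2)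
      qed (simp add: \<beta>_def)
    next
      case False
      then obtain m where "L = Suc (Suc m)" by (metis One_nat_def Suc_leI not_less_eq_eq le0 not0_implies_Suc)
      hence "qpoch (1 / q) q L = 0" using q by (simp add: qpoch_Suc_shift)
      thus ?thesis using False by (simp add: \<beta>_def)
    qed
    finally show ?thesis .
  qed
  hence "bailey_pair q 0 (\<lambda>n. (-1) powi n * q powi (tri n - n)) \<beta>"
    by (simp add: bailey_pair_def)
  from bailey_pair_chain[OF q _ this]
  have "bailey_pair q 0 (\<lambda>n. q powi n\<^sup>2 * ((-1) powi n * q powi (tri n - n)))
          (\<lambda>L. \<Sum>s\<le>L. q ^ s\<^sup>2 / qpoch q q (L - s) * \<beta> s)" by simp
  moreover have "(\<Sum>s\<le>L. q ^ s\<^sup>2 / qpoch q q (L - s) * \<beta> s) = q ^ L / qpoch q q L" for L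
  proof (cases L)
    case 0
    thus ?thesis by (simp add: \<beta>_def)
  next
    case (Suc m)
    have "(\<Sum>s\<le>L. q ^ s\<^sup>2 / qpoch q q (L - s) * \<beta> s) = (\<Sum>s\<in>{0, 1}. q ^ s\<^sup>2 / qpoch q q (L - s) * \<beta> s)"
      by (rule sum.mono_neutral_right) (auto simp: \<beta>_def Suc)
    also have "\<dots> = 1 / qpoch q q (Suc m) - 1 / qpoch q q m"
      using q by (simp add: \<beta>_def Suc)
    also have "\<dots> = q ^ L / qpoch q q L"
      using q power_ne_1[OF q(1), of "Suc m"] by (simp add: Suc qpoch_Suc field_simps)
    finally show ?thesis .
  qed
  ultimately show ?thesis by simp
qed

text \<open>The parameters \<open>(a, e, c)\<close> encode the linear terms: \<open>a\<close> shifts the pair, \<open>e\<close> is the linear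
  term in \<open>i\<close> on the \<open>\<beta>\<close> side, and \<open>c\<close> the resulting one on the \<open>\<alpha>\<close> side.\<close>

lemma bailey_pair_quintic:
  assumes q: "norm q < 1" "q \<noteq> 0" and params: "(a, e, c) \<in> {(0, 0, 0), (0, 1, - 1), (1, 1, 2)}"
  shows "bailey_pair q a (\<lambda>n. (-1) powi n * q powi (tri n + 2 * n\<^sup>2 + c * n))
           (\<lambda>L. \<Sum>i\<le>L. q ^ (i\<^sup>2 + e * i) / (qpoch q q i * qpoch q q (L - i)))"
proof -
  \<comment> \<open>If \<open>e = a\<close>, each of the two chain steps contributes
    \<open>a * n\<close>, hence \<open>c = 2a\<close>. In the other case \<open>c = -1\<close> is
    the \<open>- n\<close> in the exponent of the shifted seed.\<close>
  consider "e = a" "c = 2 * int a" "a \<le> 1" | "a = 0" "e = 1" "c = - 1" using params by auto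
  thus ?thesis
  proof cases
    case 1
    have eq: "q powi (n\<^sup>2 + int a * n) * (q powi (n\<^sup>2 + int a * n) * ((-1) powi n * q powi tri n))
        = (-1) powi n * q powi (tri n + 2 * n\<^sup>2 + c * n)" for n
    proof -
      have "tri n + 2 * n\<^sup>2 + c * n = (n\<^sup>2 + int a * n) + (n\<^sup>2 + int a * n) + tri n"
        by (simp add: 1 algebra_simps)
      thus ?thesis using q by (simp only: power_int_add simp_thms) (simp add: mult_ac)
    qed
    show ?thesis using bailey_pair_chain[OF q 1(3) bailey_pair_chain_unit[OF q 1(3)]] 1(1)
      unfolding eq by (simp add: mult.commute[of "qpoch q q (_ - _)"])
  next
    case 2
    have eq: "q powi n\<^sup>2 * (q powi n\<^sup>2 * ((-1) powi n * q powi (tri n - n)))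
        = (-1) powi n * q powi (tri n + 2 * n\<^sup>2 + c * n)" for n
    proof -
      have "tri n + 2 * n\<^sup>2 + c * n = n\<^sup>2 + n\<^sup>2 + (tri n - n)" by (simp add: 2)
      thus ?thesis using q by (simp only: power_int_add simp_thms) (simp add: mult_ac power_int_diff)
    qed
    show ?thesis using bailey_pair_chain[OF q _ bailey_pair_chain_unit_shifted[OF q]] 2(1,2)
      by (simp add: eq power_add mult.commute[of "qpoch q q (_ - _)"])
  qed
qed

lemma abs_le_power2_int: "\<bar>n\<bar> \<le> (n::int)\<^sup>2"
proof (cases "n = 0")
  case False
  hence "\<bar>n\<bar> * 1 \<le> \<bar>n\<bar> * \<bar>n\<bar>" by (intro mult_left_mono) auto
  thus ?thesis by (simp add: power2_eq_square flip: abs_mult)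
qed simp

text \<open>Twice the exponent is \<open>5n^2 + (2c-1)n\<close> with \<open>2c - 1\<close> between
  -3 and 3, hence at least \<open>2 * \<bar>n\<bar>\<close>.\<close>

lemma quintic_alpha_bound:
  fixes q :: complex
  assumes q: "norm q \<le> r" "r < 1" "q \<noteq> 0" and c: "c \<in> {0, - 1, 2}"
  shows "norm ((-1) powi n * q powi (tri n + 2 * n\<^sup>2 + c * n)) \<le> r ^ nat \<bar>n\<bar>"
proof -
  define E where "E = tri n + 2 * n\<^sup>2 + c * n"
  have "2 * E = 5 * n\<^sup>2 + (2 * c - 1) * n"
    using two_tri[of n] by (simp add: E_def power2_eq_square algebra_simps)
  hence "2 * E \<ge> 2 * \<bar>n\<bar>" using abs_le_power2_int[of n] c by auto
  hence E: "nat \<bar>n\<bar> \<le> nat E" "E \<ge> 0" by auto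
  have "norm ((-1) powi n * q powi E) = norm q ^ nat E"
    using E(2) by (simp add: norm_mult norm_power power_int_def[of q])
  also have "\<dots> \<le> norm q ^ nat \<bar>n\<bar>"
    using E q by (intro power_decreasing) auto
  also have "\<dots> \<le> r ^ nat \<bar>n\<bar>" using q by (intro power_mono) auto
  finally show ?thesis by (simp add: E_def)
qed

text \<open>Euler's sum \<open>(-z/q\<^sup>s; q)\<^sub>\<infinity>\<close>, with the factors that contain negative powers of \<open>q\<close> reversed.\<close>

lemma euler_shifted_has_sum:
  fixes q z :: complex
  assumes q: "norm q < 1" "q \<noteq> 0" and z: "z \<noteq> 0"
  shows "((\<lambda>k. q powi (tri (int k) - int k * int s) * z ^ k / qpoch q q k) has_sum
           (qpoch_inf (- z) q * (z ^ s * qpoch (- q / z) q s / q ^ (Suc s choose 2)))) UNIV"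
proof -
  define x where "x = - z / q ^ s"
  have "((\<lambda>k. (-1) ^ k * q ^ (k choose 2) * (\<Prod>i<k. x - 0 * q ^ i) / (qpoch q q k * qpoch 0 q k))
          has_sum (qpoch_inf x q / qpoch_inf 0 q)) UNIV"
    by (rule phi_has_sum[OF q(1)]) simp
  also have "qpoch_inf x q / qpoch_inf 0 q = qpoch_inf (- z) q * (z ^ s * qpoch (- q / z) q s / q ^ (Suc s choose 2))"
  proof -
    have "qpoch_inf x q = qpoch x q s * qpoch_inf (- z) q"
      using qpoch_inf_split[OF q(1), of x s] q by (simp add: x_def)
    moreover have "qpoch x q s = z ^ s * qpoch (- q / z) q s / q ^ (Suc s choose 2)"
      using qpoch_reverse[OF q(2), of "- z" s] z q by (simp add: x_def field_simps)
    ultimately show ?thesis by (simp add: qpoch_inf_def)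
  qed
  also have "(\<lambda>k. (-1) ^ k * q ^ (k choose 2) * (\<Prod>i<k. x - 0 * q ^ i) / (qpoch q q k * qpoch 0 q k))
      = (\<lambda>k. q powi (tri (int k) - int k * int s) * z ^ k / qpoch q q k)"
  proof
    fix k
    have "q powi (tri (int k) - int k * int s) = q ^ (k choose 2) / (q ^ s) ^ k"
      using q by (simp add: power_int_diff tri_of_nat mult.commute[of "int k"] power_int_mult)
    moreover have "(-1) ^ k * x ^ k = z ^ k / (q ^ s) ^ k"
      by (simp add: x_def power_divide flip: power_mult_distrib)
    moreover have "(-1) ^ k * q ^ (k choose 2) * x ^ k = ((-1) ^ k * x ^ k) * q ^ (k choose 2)"
      by (simp add: mult_ac)
    ultimately show "(-1) ^ k * q ^ (k choose 2) * (\<Prod>i<k. x - 0 * q ^ i) / (qpoch q q k * qpoch 0 q k)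
        = q powi (tri (int k) - int k * int s) * z ^ k / qpoch q q k"
      by (simp add: qpoch_def[of 0])
  qed
  finally show ?thesis .
qed

text \<open>Common source of all five identities. One factor \<open>(-z; p)_inf\<close> comes from
  Euler's sum over \<open>k\<close>, the other from the q-Gauss sum over \<open>s\<close>. The
  linear lower bound on \<open>E\<close> secures absolute summability; \<gamma> stays abstract
  because the quotient of Pochhammer symbols simplifies differently in each case.\<close>

lemma triple_sum_quintic:
  fixes q p z :: complex and E :: "nat \<Rightarrow> nat \<Rightarrow> nat \<Rightarrow> int"
  assumes q: "norm q < 1" "q \<noteq> 0" and p: "p = q ^ b" "b > 0"
    and z: "z \<noteq> 0" "norm z \<le> 1" "z \<noteq> - 1" "norm (z * p ^ a) \<le> norm q"
    and params: "(a, e, c) \<in> {(0, 0, 0), (0, 1, - 1), (1, 1, 2)}"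
    and E: "\<And>i j k. E i j k \<ge> int i + int j + int k - 6"
    and qE: "\<And>i j k. q powi (E i j k) =
        p ^ ((i + j)\<^sup>2 + a * (i + j) + (i\<^sup>2 + e * i)) * (p powi (tri (int k) - int k * int (i + j)) * z ^ k)"
    and \<gamma>: "\<And>n. ((-1) powi (int n) * p powi (tri (int n) + 2 * (int n)\<^sup>2 + c * int n)
                + (-1) powi (- int a - int n) * p powi (tri (- int a - int n) + 2 * (- int a - int n)\<^sup>2 + c * (- int a - int n))) *
                 (z ^ n * p ^ ((n choose 2) + a * n) * qpoch (- p / z) p n / qpoch (- z) p (n + a))
               = \<gamma> (int n) + \<gamma> (- int a - int n)"
    and V: "(\<gamma> has_sum V) UNIV"
  shows "((\<lambda>(i, j, k). q powi (E i j k) / (qpoch p p i * qpoch p p j * qpoch p p k))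
           has_sum (qpoch_inf (- z) p ^ 2 / qpoch_inf p p * V)) UNIV"
proof -
  have p': "norm p < 1" "p \<noteq> 0" "norm p \<le> norm q"
    using q p power_decreasing[of 1 b "norm q"]
    by (auto simp: norm_power power_less_one_iff)
  note nz = minus_mult_power_ne_1[OF p'(1) z(2,3)]
  define \<beta> where "\<beta> L = (\<Sum>i\<le>L. p ^ (i\<^sup>2 + e * i) / (qpoch p p i * qpoch p p (L - i)))" for L
  have B: "bailey_pair p a (\<lambda>n. (-1) powi n * p powi (tri n + 2 * n\<^sup>2 + c * n)) \<beta>"
    unfolding \<beta>_def by (rule bailey_pair_quintic[OF p'(1,2) params])
  have a: "a \<le> 1" and c: "c \<in> {0, - 1, 2}" using params by auto
  define g where "g s = qpoch_inf (- z) p * (z ^ s * p ^ ((s choose 2) + a * s) * qpoch (- p / z) p s)" for s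
  define h where "h i j = p ^ (i\<^sup>2 + e * i) / (qpoch p p i * qpoch p p j)" for i j
  have "((\<lambda>s. z ^ s * p ^ ((s choose 2) + a * s) * qpoch (- p / z) p s * \<beta> s)
           has_sum (qpoch_inf (- z) p / qpoch_inf p p * V)) UNIV"
    by (rule bailey_pair_limit[OF p'(1) z(1) nz a B _ q(1) z(4) quintic_alpha_bound[OF p'(3) q(1) p'(2) c] \<gamma> V]) simp
  from has_sum_cmult_right[OF this, of "qpoch_inf (- z) p"]
  have outer: "((\<lambda>s. g s * (\<Sum>i\<le>s. h i (s - i))) has_sum (qpoch_inf (- z) p ^ 2 / qpoch_inf p p * V)) UNIV"
    by (simp add: g_def h_def \<beta>_def power2_eq_square mult_ac)
  obtain C where C: "C > 0" "\<And>n. norm (inverse (qpoch p p n)) \<le> C"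
    using inverse_qpoch_bounded[OF p'(1) power_Suc_ne_1[OF p'(1)]] by blast
  show ?thesis
  proof (rule triple_has_sum[OF _ q(1) _ _ outer])
    fix i j k
    have "norm (q powi (E i j k)) \<le> norm q powi (int (i + j + k) - 6)"
      unfolding norm_power_int using q E[of i j k] by (intro power_int_decreasing) auto
    also have "\<dots> = norm q ^ (i + j + k) * (1 / norm q ^ 6)"
      using q by (subst power_int_diff) (auto simp del: of_nat_add)
    finally have "norm (q powi (E i j k) * (inverse (qpoch p p i) * inverse (qpoch p p j) * inverse (qpoch p p k)))
      \<le> (norm q ^ (i + j + k) * (1 / norm q ^ 6)) * (C * C * C)"
      unfolding norm_mult using C by (intro mult_mono) auto
    thus "norm (case (i, j, k) of (i, j, k) \<Rightarrow> q powi (E i j k) / (qpoch p p i * qpoch p p j * qpoch p p k))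
       \<le> (1 / norm q ^ 6 * (C * C * C)) * norm q ^ (i + j + k)"
      by (simp add: field_simps)
  next
    fix i j :: nat
    define s where "s = i + j"
    \<comment> \<open>One of the two triangular numbers in \<open>s^2\<close> cancels the
      denominator left by reversing the factors in Euler's sum.\<close>
    have "s\<^sup>2 = (s choose 2) + (Suc s choose 2)"
      by (induction s) (auto simp: Suc_choose_two power2_eq_square)
    hence "p ^ (s\<^sup>2 + a * s) = p ^ ((s choose 2) + a * s) * p ^ (Suc s choose 2)"
      by (simp add: power_add)
    hence "p ^ (s\<^sup>2 + a * s) * h i j * (qpoch_inf (- z) p * (z ^ s * qpoch (- p / z) p s / p ^ (Suc s choose 2))) = g s * h i j"
      using p' by (simp add: g_def)
    with has_sum_cmult_right[OF euler_shifted_has_sum[OF p'(1,2) z(1), of s], of "p ^ (s\<^sup>2 + a * s) * h i j"]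
    have "((\<lambda>k. p ^ (s\<^sup>2 + a * s) * h i j * (p powi (tri (int k) - int k * int s) * z ^ k / qpoch p p k)) has_sum (g s * h i j)) UNIV"
      by simp
    moreover have "q powi (E i j k) / (qpoch p p i * qpoch p p j * qpoch p p k)
      = p ^ (s\<^sup>2 + a * s) * h i j * (p powi (tri (int k) - int k * int s) * z ^ k / qpoch p p k)" for k
      unfolding qE s_def[symmetric] h_def by (simp add: power_add)
    ultimately show "((\<lambda>k. case (i, j, k) of (i, j, k) \<Rightarrow> q powi (E i j k) / (qpoch p p i * qpoch p p j * qpoch p p k))
        has_sum (g (i + j) * h i j)) UNIV"
      by (simp add: s_def)
  qed simp
qed

section \<open>Infinite products and the five identities\<close>

lemma qpoch_inf_times_minus:
  assumes "norm q < 1"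
  shows "qpoch_inf a q * qpoch_inf (- a) q = qpoch_inf (a\<^sup>2) (q\<^sup>2)"
proof (rule LIMSEQ_unique)
  have "qpoch a q n * qpoch (- a) q n = qpoch (a\<^sup>2) (q\<^sup>2) n" for n
    unfolding qpoch_def prod.distrib[symmetric]
    by (intro prod.cong) (auto simp: algebra_simps power2_eq_square power_mult_distrib)
  thus "(\<lambda>n. qpoch a q n * qpoch (- a) q n) \<longlonglongrightarrow> qpoch_inf (a\<^sup>2) (q\<^sup>2)"
    using qpoch_LIMSEQ[of "q\<^sup>2" "a\<^sup>2"] assms by (simp add: norm_power power_less_one_iff)
  show "(\<lambda>n. qpoch a q n * qpoch (- a) q n) \<longlonglongrightarrow> qpoch_inf a q * qpoch_inf (- a) q"
    by (intro tendsto_mult qpoch_LIMSEQ assms)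
qed

lemma qpoch_inf_dissect:
  assumes "norm q < 1" "m > 0"
  shows "qpoch_inf a q = (\<Prod>j<m. qpoch_inf (a * q ^ j) (q ^ m))"
proof (rule LIMSEQ_unique)
  have "qpoch a q (m * n) = (\<Prod>j<m. qpoch (a * q ^ j) (q ^ m) n)" for n
  proof (induction n)
    case (Suc n)
    have "qpoch (a * q ^ (m * n)) q m = (\<Prod>j<m. 1 - a * q ^ j * (q ^ m) ^ n)"
      unfolding qpoch_def by (intro prod.cong) (auto simp: power_mult mult_ac)
    thus ?case using qpoch_add[of a q "m * n" m] Suc
      by (simp add: qpoch_Suc prod.distrib add.commute)
  qed simp
  moreover have "(\<lambda>n. \<Prod>j<m. qpoch (a * q ^ j) (q ^ m) n) \<longlonglongrightarrow> (\<Prod>j<m. qpoch_inf (a * q ^ j) (q ^ m))"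
    by (intro tendsto_prod qpoch_LIMSEQ) (use assms in \<open>simp add: norm_power power_less_one_iff\<close>)
  ultimately show "(\<lambda>n. qpoch a q (m * n)) \<longlonglongrightarrow> (\<Prod>j<m. qpoch_inf (a * q ^ j) (q ^ m))"
    by simp
  show "(\<lambda>n. qpoch a q (m * n)) \<longlonglongrightarrow> qpoch_inf a q"
    by (rule filterlim_compose[OF qpoch_LIMSEQ[OF assms(1)] filterlim_subseq])
       (use assms in \<open>simp add: strict_mono_def\<close>)
qed

lemma J_nonzero: "norm q < 1 \<Longrightarrow> m > 0 \<Longrightarrow> J m q \<noteq> 0"
  unfolding J_def by (rule qpoch_inf_qq_nonzero) (simp add: norm_power power_less_one_iff)

lemma qpoch_inf_odd_eq_J:
  assumes "norm q < 1" "m > 0"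
  shows "qpoch_inf (q ^ m) (q ^ (2 * m)) = J m q / J (2 * m) q"
proof -
  have "norm (q ^ m) < 1" using assms by (simp add: norm_power power_less_one_iff)
  from qpoch_inf_dissect[OF this, of 2 "q ^ m"]
  have "J m q = qpoch_inf (q ^ m) (q ^ (2 * m)) * J (2 * m) q"
    by (simp add: J_def numeral_2_eq_2 flip: power_mult power_add)
  thus ?thesis using J_nonzero[OF assms(1), of "2 * m"] assms(2) by simp
qed

lemma qpoch_inf_minus_odd_eq_J:
  assumes "norm q < 1"
  shows "qpoch_inf (- q) (q\<^sup>2) = J 2 q ^ 2 / (J 1 q * J 4 q)"
proof -
  have "norm (q\<^sup>2) < 1" using assms by (simp add: norm_power power_less_one_iff)
  from qpoch_inf_times_minus[OF this, of q]
  have "qpoch_inf q (q\<^sup>2) * qpoch_inf (- q) (q\<^sup>2) = J 2 q / J 4 q"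
    using qpoch_inf_odd_eq_J[OF assms, of 2] by simp
  moreover have "qpoch_inf q (q\<^sup>2) = J 1 q / J 2 q"
    using qpoch_inf_odd_eq_J[OF assms, of 1] by simp
  ultimately have "J 1 q / J 2 q * qpoch_inf (- q) (q\<^sup>2) = J 2 q / J 4 q" by (simp only:)
  thus ?thesis
    using J_nonzero[OF assms, of 1] J_nonzero[OF assms, of 2] J_nonzero[OF assms, of 4]
    by (simp add: field_simps power2_eq_square[of "J _ _"])
qed

lemma qpoch_inf_minus_eq_J:
  assumes "norm q < 1"
  shows "qpoch_inf (- q) q = J 2 q / J 1 q"
  using qpoch_inf_times_minus[OF assms, of q] J_nonzero[OF assms, of 1]
  by (simp add: J_def field_simps)

lemma J_minus_odd_prefactor:
  assumes "norm q < 1"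
  shows "qpoch_inf (- q) (q\<^sup>2) ^ 2 / qpoch_inf (q\<^sup>2) (q\<^sup>2) * X = J 2 q ^ 3 * X / (J 1 q ^ 2 * J 4 q ^ 2)"
proof -
  have "qpoch_inf (q\<^sup>2) (q\<^sup>2) = J 2 q" by (simp add: J_def)
  thus ?thesis unfolding qpoch_inf_minus_odd_eq_J[OF assms]
    using J_nonzero[OF assms, of 2] by (simp add: field_simps power2_eq_square power3_eq_cube)
qed

text \<open>The triple product in base \<open>q^m\<close> at \<open>y = q^l\<close>. The exponent is
  a function \<open>f\<close> so that each application can keep its own quadratic form.\<close>

lemma jacobi_has_sum_power:
  fixes q :: complex
  assumes q: "norm q < 1" "q \<noteq> 0" and m: "m > 0" "l \<le> m"
    and f: "\<And>n. f n = int l * n + int m * tri n"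
  shows "((\<lambda>n. (-1) powi n * q powi (f n)) has_sum
            (qpoch_inf (q ^ l) (q ^ m) * qpoch_inf (q ^ (m - l)) (q ^ m) * J m q)) UNIV"
proof -
  have "norm (q ^ m) < 1" using q m by (simp add: norm_power power_less_one_iff)
  from jacobi_triple_product[OF this, of "q ^ l"] q
  have "((\<lambda>n. (-1) powi n * (q ^ l) powi n * (q ^ m) powi (tri n)) has_sum
            (qpoch_inf (q ^ l) (q ^ m) * qpoch_inf (q ^ m / q ^ l) (q ^ m) * J m q)) UNIV"
    by (simp add: J_def)
  moreover have "q ^ m / q ^ l = q ^ (m - l)" using q m by (simp add: power_diff)
  moreover have "(q ^ l) powi n * (q ^ m) powi (tri n) = q powi (f n)" for n
    using q unfolding f by (simp add: power_int_add power_int_mult)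
  ultimately show ?thesis by (simp add: mult.assoc)
qed

section \<open>The five identities for nonzero \<open>q\<close>\<close>

lemma minus_one_powi_reflect:
  "(-1) powi (- int n) = ((-1) ^ n :: complex)" "(-1) powi (- 1 - int n) = (- ((-1) ^ n) :: complex)"
  by (auto simp: power_int_minus power_int_diff minus_one_power_iff)

lemma power2_powi: "(q\<^sup>2) powi n = (q :: complex) powi (2 * n)"
  by (simp only: power_int_mult power_int_numeral)

text \<open>For \<open>p = q^2\<close>, \<open>z = q\<close>, \<open>a = 0\<close> the two
  Pochhammer symbols cancel and the weight is just \<open>q^(n^2)\<close>. The exponent
  \<open>6n^2 + (2c-1)n\<close> equals \<open>12 * tri n + (5 + 2c) * n\<close>, whence
  \<open>l\<close>.\<close>

lemma triple_sum_Jam_5_3: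
  assumes q: "norm q < 1" "q \<noteq> 0"
    and c: "(e, c) \<in> {(0, 0), (1, - 1)}" and l: "int l = 5 + 2 * c"
    and E: "\<And>i j k. E i j k = 4*int i^2 + 2*int j^2 + int k^2 + 4*int i*int j - 2*int i*int k - 2*int j*int k + 2 * int e * int i"
  shows "((\<lambda>(i, j, k). q powi (E i j k) / (qpoch (q^2) (q^2) i * qpoch (q^2) (q^2) j * qpoch (q^2) (q^2) k))
      has_sum (J 2 q ^ 3 * Jam l 12 q / (J 1 q ^ 2 * J 4 q ^ 2))) UNIV"
  unfolding J_minus_odd_prefactor[OF q(1), symmetric]
proof (rule triple_sum_quintic[where b = 2 and a = 0 and e = e and c = c and \<gamma> = "\<lambda>n. (-1) powi n * q powi (6 * n\<^sup>2 + (2 * c - 1) * n)"])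
  show "norm q < 1" "q \<noteq> 0" "q \<noteq> 0" by fact+
  show "norm q \<le> 1" "norm (q * (q\<^sup>2) ^ 0) \<le> norm q" "q \<noteq> - 1" using q by auto
  show "(0, e, c) \<in> {(0, 0, 0), (0, 1, - 1), (1, 1, 2)}" using c by auto
  show "int i + int j + int k - 6 \<le> E i j k" for i j k
  proof -
    \<comment> \<open>The quadratic form is \<open>(k-i-j)^2 + (i+j)^2 + 2i^2\<close>; shifting the
      squares by 1 and 2 bounds it below by \<open>2(i+j+k) - 5\<close>.\<close>
    have "0 \<le> (int k - int i - int j - 1)\<^sup>2 + (int i + int j - 2)\<^sup>2 + 2 * (int i)\<^sup>2"
      by (intro add_nonneg_nonneg) auto
    hence "E i j k \<ge> 2 * int k + 2 * int i + 2 * int j - 5 + 2 * int e * int i"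
      by (simp add: E power2_eq_square algebra_simps)
    moreover have "2 * int e * int i \<ge> 0" by simp
    ultimately show ?thesis by linarith
  qed
  show "q powi (E i j k) = (q\<^sup>2) ^ ((i + j)\<^sup>2 + 0 * (i + j) + (i\<^sup>2 + e * i)) * ((q\<^sup>2) powi (tri (int k) - int k * int (i + j)) * q ^ k)" for i j k
  proof -
    have "E i j k = 2 * int ((i + j)\<^sup>2 + 0 * (i + j) + (i\<^sup>2 + e * i)) + (2 * (tri (int k) - int k * int (i + j)) + int k)"
      using two_tri[of "int k"] by (simp add: E power2_eq_square algebra_simps)
    thus ?thesis using q
      by (simp only: power_int_add power_int_mult simp_thms power_int_numeral power_int_of_nat)
  qed
  show "((-1) powi (int n) * (q\<^sup>2) powi (tri (int n) + 2 * (int n)\<^sup>2 + c * int n)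
                + (-1) powi (- int 0 - int n) * (q\<^sup>2) powi (tri (- int 0 - int n) + 2 * (- int 0 - int n)\<^sup>2 + c * (- int 0 - int n))) *
                 (q ^ n * (q\<^sup>2) ^ ((n choose 2) + 0 * n) * qpoch (- q\<^sup>2 / q) (q\<^sup>2) n / qpoch (- q) (q\<^sup>2) (n + 0))
       = (-1) powi int n * q powi (6 * (int n)\<^sup>2 + (2 * c - 1) * int n) +
         (-1) powi (- int 0 - int n) * q powi (6 * (- int 0 - int n)\<^sup>2 + (2 * c - 1) * (- int 0 - int n))" for n
  proof -
    have "qpoch (- q) (q\<^sup>2) n \<noteq> 0"
      using q by (intro qpoch_nonzero minus_mult_power_ne_1) (auto simp: norm_power power_less_one_iff)
    moreover have "- q\<^sup>2 / q = - q" using q by (simp add: power2_eq_square)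
    moreover have "q ^ n * (q\<^sup>2) ^ (n choose 2) = q powi (int n)\<^sup>2"
    proof -
      have "n + 2 * (n choose 2) = n\<^sup>2" by (induction n) (auto simp: Suc_choose_two power2_eq_square)
      thus ?thesis by (metis of_nat_power power_add power_int_of_nat power_mult)
    qed
    moreover have "(q\<^sup>2) powi (tri m + 2 * m\<^sup>2 + c * m) * q powi m\<^sup>2 = q powi (6 * m\<^sup>2 + (2 * c - 1) * m)" for m
    proof -
      have "6 * m\<^sup>2 + (2 * c - 1) * m = 2 * (tri m + 2 * m\<^sup>2 + c * m) + m\<^sup>2"
        using two_tri[of m] by (simp add: power2_eq_square algebra_simps)
      thus ?thesis using q by (simp only: power_int_add power_int_mult simp_thms power_int_numeral)
    qed
    from this[of "int n"] this[of "- int n"] calculation show ?thesis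
      by (simp add: distrib_right mult.assoc)
  qed
  have "((\<lambda>n. (-1) powi n * q powi (6 * n\<^sup>2 + (2 * c - 1) * n)) has_sum
         (qpoch_inf (q ^ l) (q ^ 12) * qpoch_inf (q ^ (12 - l)) (q ^ 12) * J 12 q)) UNIV"
  proof (rule jacobi_has_sum_power[OF q])
    show "l \<le> 12" using l c by auto
    show "6 * n\<^sup>2 + (2 * c - 1) * n = int l * n + int 12 * tri n" for n
      using two_tri[of n] l by (simp add: power2_eq_square algebra_simps)
  qed simp
  thus "((\<lambda>n. (-1) powi n * q powi (6 * n\<^sup>2 + (2 * c - 1) * n)) has_sum Jam l 12 q) UNIV"
    by (simp add: Jam_def)
qed simp_all


text \<open>With \<open>a = 1\<close> the Pochhammer quotient is \<open>1/(1+x)\<close> for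
  \<open>x = q^(2n+1)\<close>, no monomial. The terms at \<open>n\<close> and \<open>-1-n\<close>
  together carry \<open>1 - x^2\<close>, and the quotient \<open>1 - x\<close> again gives two theta
  terms.\<close>

lemma triple_sum_Jam_1:
  assumes q: "norm q < 1" "q \<noteq> 0"
    and E: "\<And>i j k. E i j k = 4*int i^2 + 2*int j^2 + int k^2 + 4*int i*int j - 2*int i*int k - 2*int j*int k + 4 * int i + 2 * int j"
  shows "((\<lambda>(i, j, k). q powi (E i j k) / (qpoch (q^2) (q^2) i * qpoch (q^2) (q^2) j * qpoch (q^2) (q^2) k))
      has_sum (J 2 q ^ 3 * Jam 1 12 q / (J 1 q ^ 2 * J 4 q ^ 2))) UNIV"
  unfolding J_minus_odd_prefactor[OF q(1), symmetric]
proof (rule triple_sum_quintic[where b = 2 and a = 1 and e = 1 and c = 2 and \<gamma> = "\<lambda>n. (-1) powi n * q powi (6 * n\<^sup>2 + 5 * n)"])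
  show "norm q < 1" "q \<noteq> 0" "q \<noteq> 0" by fact+
  show "norm q \<le> 1" "q \<noteq> - 1" using q by auto
  show "norm (q * (q\<^sup>2) ^ 1) \<le> norm q"
    using q by (simp add: norm_mult norm_power mult_left_le power_le_one)
  show "int i + int j + int k - 6 \<le> E i j k" for i j k
  proof -
    have "0 \<le> (int k - int i - int j - 1)\<^sup>2 + (int i + int j - 2)\<^sup>2 + 2 * (int i)\<^sup>2"
      by (intro add_nonneg_nonneg) auto
    thus ?thesis by (simp add: E power2_eq_square algebra_simps)
  qed
  show "q powi (E i j k) = (q\<^sup>2) ^ ((i + j)\<^sup>2 + 1 * (i + j) + (i\<^sup>2 + 1 * i)) * ((q\<^sup>2) powi (tri (int k) - int k * int (i + j)) * q ^ k)" for i j k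
  proof -
    have "E i j k = 2 * int ((i + j)\<^sup>2 + 1 * (i + j) + (i\<^sup>2 + 1 * i)) + (2 * (tri (int k) - int k * int (i + j)) + int k)"
      using two_tri[of "int k"] by (simp add: E power2_eq_square algebra_simps)
    thus ?thesis using q
      by (simp only: power_int_add power_int_mult simp_thms power_int_numeral power_int_of_nat)
  qed
  show "((-1) powi (int n) * (q\<^sup>2) powi (tri (int n) + 2 * (int n)\<^sup>2 + 2 * int n)
                + (-1) powi (- int 1 - int n) * (q\<^sup>2) powi (tri (- int 1 - int n) + 2 * (- int 1 - int n)\<^sup>2 + 2 * (- int 1 - int n))) *
                 (q ^ n * (q\<^sup>2) ^ ((n choose 2) + 1 * n) * qpoch (- q\<^sup>2 / q) (q\<^sup>2) n / qpoch (- q) (q\<^sup>2) (n + 1))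
       = (-1) powi int n * q powi (6 * (int n)\<^sup>2 + 5 * int n) +
         (-1) powi (- int 1 - int n) * q powi (6 * (- int 1 - int n)\<^sup>2 + 5 * (- int 1 - int n))" for n
  proof -
    have nz: "- q * (q\<^sup>2) ^ k \<noteq> 1" for k
      using q by (intro minus_mult_power_ne_1) (auto simp: norm_power power_less_one_iff)
    define x where "x = q ^ (2 * n + 1)"
    have "1 - (- q) * (q\<^sup>2) ^ n = 1 + x" by (simp add: x_def power_mult)
    moreover from this have x: "1 + x \<noteq> 0" using nz[of n] by (metis eq_iff_diff_eq_0)
    moreover have "- q\<^sup>2 / q = - q" using q by (simp add: power2_eq_square)
    ultimately have w: "qpoch (- q\<^sup>2 / q) (q\<^sup>2) n / qpoch (- q) (q\<^sup>2) (n + 1) = 1 / (1 + x)"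
      using qpoch_nonzero[of "- q" "q\<^sup>2" n, OF nz] by (simp add: qpoch_Suc)
    have *: "q ^ n * (q\<^sup>2) ^ ((n choose 2) + 1 * n) = q ^ (n\<^sup>2 + 2 * n)"
    proof -
      have "n + 2 * (n choose 2) = n\<^sup>2" by (induction n) (auto simp: Suc_choose_two power2_eq_square)
      hence "n + 2 * ((n choose 2) + 1 * n) = n\<^sup>2 + 2 * n" by simp
      thus ?thesis by (metis power_add power_mult)
    qed
    have 1: "(q\<^sup>2) powi (tri (int n) + 2 * (int n)\<^sup>2 + 2 * int n) = q ^ (5 * n\<^sup>2 + 3 * n)"
    proof -
      have "2 * (tri (int n) + 2 * (int n)\<^sup>2 + 2 * int n) = int (5 * n\<^sup>2 + 3 * n)"
        using two_tri[of "int n"] by (simp add: power2_eq_square algebra_simps)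
      thus ?thesis unfolding power2_powi by (simp only: power_int_of_nat)
    qed
    have 2: "(q\<^sup>2) powi (tri (- int 1 - int n) + 2 * (- int 1 - int n)\<^sup>2 + 2 * (- int 1 - int n)) = q ^ (5 * n\<^sup>2 + 3 * n) * x * x"
    proof -
      have "2 * (tri (- int 1 - int n) + 2 * (- int 1 - int n)\<^sup>2 + 2 * (- int 1 - int n)) = int ((5 * n\<^sup>2 + 3 * n) + (2 * n + 1) + (2 * n + 1))"
        using two_tri[of "- int 1 - int n"] by (simp add: power2_eq_square algebra_simps)
      thus ?thesis unfolding power2_powi x_def by (simp only: power_int_of_nat power_add)
    qed
    have 3: "q powi (6 * (int n)\<^sup>2 + 5 * int n) = q ^ (5 * n\<^sup>2 + 3 * n) * q ^ (n\<^sup>2 + 2 * n)"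
    proof -
      have "6 * (int n)\<^sup>2 + 5 * int n = int ((5 * n\<^sup>2 + 3 * n) + (n\<^sup>2 + 2 * n))" by simp
      thus ?thesis by (simp only: power_int_of_nat power_add)
    qed
    have 4: "q powi (6 * (- int 1 - int n)\<^sup>2 + 5 * (- int 1 - int n)) = q ^ (5 * n\<^sup>2 + 3 * n) * q ^ (n\<^sup>2 + 2 * n) * x"
    proof -
      have "6 * (- int 1 - int n)\<^sup>2 + 5 * (- int 1 - int n) = int ((5 * n\<^sup>2 + 3 * n) + (n\<^sup>2 + 2 * n) + (2 * n + 1))"
        by (simp add: power2_eq_square algebra_simps)
      thus ?thesis unfolding x_def by (simp only: power_int_of_nat power_add)
    qed
    have sgn: "(-1) powi (- int 1 - int n) = (- ((-1) ^ n) :: complex)"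
      using minus_one_powi_reflect(2)[of n] by simp
    define A where "A = q ^ (5 * n\<^sup>2 + 3 * n)"
    define B where "B = q ^ (n\<^sup>2 + 2 * n)"
    have "((-1) ^ n * A + - ((-1) ^ n) * (A * x * x)) * (B * (1 / (1 + x))) = (-1) ^ n * (A * B) + - ((-1) ^ n) * (A * B * x)"
    proof -
      have "(-1) ^ n * A + - ((-1) ^ n) * (A * x * x) = ((-1) ^ n * A * (1 - x)) * (1 + x)"
        by (simp add: algebra_simps)
      moreover have "u * (1 + x) * (B * (1 / (1 + x))) = u * B" for u using x by simp
      ultimately have "((-1) ^ n * A + - ((-1) ^ n) * (A * x * x)) * (B * (1 / (1 + x))) = (-1) ^ n * A * (1 - x) * B"
        by (simp only:)
      thus ?thesis by (simp only:) (simp add: algebra_simps)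
    qed
    thus ?thesis unfolding times_divide_eq_right[symmetric] w * 1 2 3 4 sgn A_def B_def power_int_of_nat .
  qed
  \<comment> \<open>The triple product is read off with \<open>l = 11\<close>; \<open>Jam\<close> is
    symmetric under exchanging 11 and 1.\<close>
  have "((\<lambda>n. (-1) powi n * q powi (6 * n\<^sup>2 + 5 * n)) has_sum
         (qpoch_inf (q ^ 11) (q ^ 12) * qpoch_inf (q ^ (12 - 11)) (q ^ 12) * J 12 q)) UNIV"
  proof (rule jacobi_has_sum_power[OF q])
    show "6 * n\<^sup>2 + 5 * n = int 11 * n + int 12 * tri n" for n
      using two_tri[of n] by (simp add: power2_eq_square algebra_simps)
  qed simp_all
  thus "((\<lambda>n. (-1) powi n * q powi (6 * n\<^sup>2 + 5 * n)) has_sum Jam 1 12 q) UNIV"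
    by (simp add: Jam_def mult_ac)
qed simp_all

lemma triple_sum_J3:
  assumes q: "norm q < 1" "q \<noteq> 0"
    and E: "\<And>i j k. E i j k = (4*int i^2 + 2*int j^2 + int k^2 + 4*int i*int j - 2*int i*int k - 2*int j*int k + int k) div 2"
  shows "((\<lambda>(i, j, k). q powi (E i j k) / (qpoch q q i * qpoch q q j * qpoch q q k))
      has_sum (J 2 q ^ 2 * J 3 q ^ 2 / (J 1 q ^ 3 * J 6 q))) UNIV"
proof -
  \<comment> \<open>The \<open>div\<close> is exact, since \<open>k^2 + k\<close> is even and the
    other terms have even coefficients.\<close>
  have E2: "2 * E i j k = 4*int i^2 + 2*int j^2 + int k^2 + 4*int i*int j - 2*int i*int k - 2*int j*int k + int k" for i j k
  proof -
    have "4*int i^2 + 2*int j^2 + int k^2 + 4*int i*int j - 2*int i*int k - 2*int j*int k + int k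
       = 2 * (2*int i^2 + int j^2 + 2*int i*int j - int i*int k - int j*int k + tri (int k) + int k)"
      using two_tri[of "int k"] by (simp add: power2_eq_square algebra_simps)
    thus ?thesis by (simp add: E)
  qed
  have "((\<lambda>(i, j, k). q powi (E i j k) / (qpoch q q i * qpoch q q j * qpoch q q k))
      has_sum (qpoch_inf (- q) q ^ 2 / qpoch_inf q q * ((J 3 q / J 6 q) ^ 2 * J 6 q))) UNIV"
  proof (rule triple_sum_quintic[where b = 1 and a = 0 and e = 0 and c = 0 and \<gamma> = "\<lambda>n. (-1) powi n * q powi (3 * n\<^sup>2)"])
    show "norm q < 1" "q \<noteq> 0" "q \<noteq> 0" by fact+
    show "norm q \<le> 1" "norm (q * q ^ 0) \<le> norm q" "q \<noteq> - 1" using q by auto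
    show "int i + int j + int k - 6 \<le> E i j k" for i j k
    proof -
      have "0 \<le> (int k - int i - int j - 1)\<^sup>2 + (int i + int j - 2)\<^sup>2 + 2 * (int i)\<^sup>2"
        by (intro add_nonneg_nonneg) auto
      hence "2 * E i j k \<ge> 2 * int k + 2 * int i + 2 * int j - 5"
        unfolding E2 by (simp add: power2_eq_square algebra_simps)
      thus ?thesis by linarith
    qed
    show "q powi (E i j k) = q ^ ((i + j)\<^sup>2 + 0 * (i + j) + (i\<^sup>2 + 0 * i)) * (q powi (tri (int k) - int k * int (i + j)) * q ^ k)" for i j k
    proof -
      have "E i j k = int ((i + j)\<^sup>2 + 0 * (i + j) + (i\<^sup>2 + 0 * i)) + (tri (int k) - int k * int (i + j) + int k)"
        using two_tri[of "int k"] E2[of i j k] by (simp add: power2_eq_square algebra_simps)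
      thus ?thesis using q by (simp only: power_int_add simp_thms power_int_of_nat)
    qed
    show "((-1) powi (int n) * q powi (tri (int n) + 2 * (int n)\<^sup>2 + 0 * int n)
                + (-1) powi (- int 0 - int n) * q powi (tri (- int 0 - int n) + 2 * (- int 0 - int n)\<^sup>2 + 0 * (- int 0 - int n))) *
                 (q ^ n * q ^ ((n choose 2) + 0 * n) * qpoch (- q / q) q n / qpoch (- q) q (n + 0))
       = (-1) powi int n * q powi (3 * (int n)\<^sup>2) + (-1) powi (- int 0 - int n) * q powi (3 * (- int 0 - int n)\<^sup>2)" for n
    proof -
      have nz: "qpoch (- q) q n \<noteq> 0"
        using q by (intro qpoch_nonzero minus_mult_power_ne_1) auto
      \<comment> \<open>Here \<open>z = q = p\<close>, so the quotient is
        \<open>(-1; q)_n / (-q; q)_n = 2/(1 + q^n)\<close>; its denominator is cancelled by the sum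
        of the \<alpha> at \<open>n\<close> and \<open>-n\<close>.\<close>
      have "(1 + q ^ n) * qpoch (- q / q) q n = 2 * qpoch (- q) q n"
        using qpoch_Suc[of "- 1" q n] qpoch_Suc_shift[of "- 1" q n] q by (simp add: mult.commute)
      hence w: "(1 + q ^ n) * (qpoch (- q / q) q n / qpoch (- q) q n) = 2" using nz by simp
      have ex: "(n choose 2) + 2 * n\<^sup>2 + (n + (n choose 2)) = 3 * n\<^sup>2"
        by (induction n) (auto simp: Suc_choose_two power2_eq_square)
      have 1: "q powi (tri (int n) + 2 * (int n)\<^sup>2) = q ^ ((n choose 2) + 2 * n\<^sup>2)"
        by (simp add: tri_of_nat flip: power_int_of_nat)
      have 2: "q powi (tri (- int n) + 2 * (int n)\<^sup>2) = q ^ ((n choose 2) + 2 * n\<^sup>2) * q ^ n"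
        using q by (simp add: tri_minus tri_of_nat power_add power_int_add flip: power_int_of_nat)
      have 3: "q powi (3 * (int n)\<^sup>2) = q ^ ((n choose 2) + 2 * n\<^sup>2) * (q ^ n * q ^ (n choose 2))"
        by (metis ex of_nat_mult of_nat_numeral of_nat_power power_add power_int_of_nat)
      define A where "A = q ^ ((n choose 2) + 2 * n\<^sup>2)"
      define B where "B = q ^ n * q ^ (n choose 2)"
      define R where "R = qpoch (- q / q) q n / qpoch (- q) q n"
      have "((-1) ^ n * A + (-1) ^ n * (A * q ^ n)) * (B * R) = (-1) ^ n * (A * B) * ((1 + q ^ n) * R)"
        by (simp add: algebra_simps)
      also have "\<dots> = (-1) ^ n * (A * B) + (-1) ^ n * (A * B)" unfolding R_def w by simp
      finally show ?thesis
        unfolding A_def B_def R_def by (simp add: 1 2 3 minus_one_powi_reflect)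
    qed
    have "((\<lambda>n. (-1) powi n * q powi (3 * n\<^sup>2)) has_sum
           (qpoch_inf (q ^ 3) (q ^ 6) * qpoch_inf (q ^ (6 - 3)) (q ^ 6) * J 6 q)) UNIV"
    proof (rule jacobi_has_sum_power[OF q])
      show "3 * n\<^sup>2 = int 3 * n + int 6 * tri n" for n
        using two_tri[of n] by (simp add: power2_eq_square algebra_simps)
    qed simp_all
    thus "((\<lambda>n. (-1) powi n * q powi (3 * n\<^sup>2)) has_sum ((J 3 q / J 6 q) ^ 2 * J 6 q)) UNIV"
      using qpoch_inf_odd_eq_J[OF q(1), of 3] by (simp add: power2_eq_square[of "_ / _"])
  qed simp_all
  also have "qpoch_inf (- q) q ^ 2 / qpoch_inf q q * ((J 3 q / J 6 q) ^ 2 * J 6 q) = J 2 q ^ 2 * J 3 q ^ 2 / (J 1 q ^ 3 * J 6 q)"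
  proof -
    have "qpoch_inf q q = J 1 q" by (simp add: J_def)
    thus ?thesis unfolding qpoch_inf_minus_eq_J[OF q(1)]
      using J_nonzero[OF q(1), of 1] J_nonzero[OF q(1), of 6]
      by (simp add: field_simps power2_eq_square power3_eq_cube)
  qed
  finally show ?thesis .
qed

text \<open>At \<open>z = 1\<close> the Pochhammer quotient is the constant \<open>1/2\<close>,
  while \<open>(-1; q)_inf^2\<close> is \<open>4 * (-q; q)_inf^2\<close>; together they give the
  factor 2 of the result.\<close>

lemma triple_sum_J6:
  assumes q: "norm q < 1" "q \<noteq> 0"
    and E: "\<And>i j k. E i j k = (4*int i^2 + 2*int j^2 + int k^2 + 4*int i*int j - 2*int i*int k - 2*int j*int k + 4*int i + 2*int j - int k) div 2"
  shows "((\<lambda>(i, j, k). q powi (E i j k) / (qpoch q q i * qpoch q q j * qpoch q q k))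
      has_sum (2 * (J 2 q * J 6 q ^ 2 / (J 1 q ^ 2 * J 3 q)))) UNIV"
proof -
  have E': "E i j k = 2*int i^2 + int j^2 + 2*int i*int j - int i*int k - int j*int k + tri (int k) + 2*int i + int j" for i j k
  proof -
    have "4*int i^2 + 2*int j^2 + int k^2 + 4*int i*int j - 2*int i*int k - 2*int j*int k + 4*int i + 2*int j - int k
       = 2 * (2*int i^2 + int j^2 + 2*int i*int j - int i*int k - int j*int k + tri (int k) + 2*int i + int j)"
      using two_tri[of "int k"] by (simp add: power2_eq_square algebra_simps)
    thus ?thesis by (simp add: E)
  qed
  define V where "V = 1 / 2 * (qpoch_inf (q ^ 5) (q ^ 6) * qpoch_inf q (q ^ 6) * J 6 q)"
  have "((\<lambda>(i, j, k). q powi (E i j k) / (qpoch q q i * qpoch q q j * qpoch q q k))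
      has_sum (qpoch_inf (- 1) q ^ 2 / qpoch_inf q q * V)) UNIV"
  proof (rule triple_sum_quintic[where b = 1 and a = 1 and e = 1 and c = 2 and \<gamma> = "\<lambda>n. 1 / 2 * ((-1) powi n * q powi (3 * n\<^sup>2 + 2 * n))"])
    show "norm q < 1" "q \<noteq> 0" by fact+
    show "int i + int j + int k - 6 \<le> E i j k" for i j k
    proof -
      \<comment> \<open>The first shift is 2 rather than 1 to outweigh the linear term
        \<open>- k\<close>.\<close>
      have "0 \<le> (int k - int i - int j - 2)\<^sup>2 + (int i + int j - 2)\<^sup>2 + 2 * (int i)\<^sup>2"
        by (intro add_nonneg_nonneg) auto
      hence "2 * E i j k \<ge> 2 * int k + 2 * int i + 2 * int j - 12"
        using two_tri[of "int k"] unfolding E' by (simp add: power2_eq_square algebra_simps)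
      thus ?thesis by linarith
    qed
    show "q powi (E i j k) = q ^ ((i + j)\<^sup>2 + 1 * (i + j) + (i\<^sup>2 + 1 * i)) * (q powi (tri (int k) - int k * int (i + j)) * 1 ^ k)" for i j k
    proof -
      have "E i j k = int ((i + j)\<^sup>2 + 1 * (i + j) + (i\<^sup>2 + 1 * i)) + (tri (int k) - int k * int (i + j))"
        unfolding E' by (simp add: power2_eq_square algebra_simps)
      thus ?thesis using q by (simp only: power_int_add simp_thms power_int_of_nat power_one mult_1_right)
    qed
    show "((-1) powi (int n) * q powi (tri (int n) + 2 * (int n)\<^sup>2 + 2 * int n)
                + (-1) powi (- int 1 - int n) * q powi (tri (- int 1 - int n) + 2 * (- int 1 - int n)\<^sup>2 + 2 * (- int 1 - int n))) *
                 (1 ^ n * q ^ ((n choose 2) + 1 * n) * qpoch (- q / 1) q n / qpoch (- 1) q (n + 1))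
       = 1 / 2 * ((-1) powi int n * q powi (3 * (int n)\<^sup>2 + 2 * int n)) +
         1 / 2 * ((-1) powi (- int 1 - int n) * q powi (3 * (- int 1 - int n)\<^sup>2 + 2 * (- int 1 - int n)))" for n
    proof -
      have nz: "qpoch (- q) q n \<noteq> 0"
        using q by (intro qpoch_nonzero minus_mult_power_ne_1) auto
      hence w: "qpoch (- q / 1) q n / qpoch (- 1) q (n + 1) = 1 / 2"
        by (simp add: qpoch_Suc_shift)
      \<comment> \<open>The weight exponent is \<open>(m^2 + m)/2\<close> both for
        \<open>m = n\<close> and for \<open>m = -1-n\<close>, so it can be absorbed term by
        term.\<close>
      have shift: "q powi (tri m + 2 * m\<^sup>2 + 2 * m) * q ^ ((n choose 2) + 1 * n) = q powi (3 * m\<^sup>2 + 2 * m)"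
        if "m = int n \<or> m = - int 1 - int n" for m
      proof -
        have "2 * (3 * m\<^sup>2 + 2 * m) = 2 * (tri m + 2 * m\<^sup>2 + 2 * m) + (m\<^sup>2 + m)"
          using two_tri[of m] by (simp add: power2_eq_square algebra_simps)
        moreover have "m\<^sup>2 + m = 2 * int ((n choose 2) + 1 * n)"
        proof -
          have "m\<^sup>2 + m = (int n)\<^sup>2 + int n"
            using that by (elim disjE; hypsubst) (simp_all add: power2_eq_square algebra_simps)
          thus ?thesis using two_tri[of "int n"] by (simp add: tri_of_nat power2_eq_square algebra_simps)
        qed
        moreover have "u = v + w" if "2 * u = 2 * v + x" "x = 2 * w" for u v w x :: int using that by simp
        ultimately have "3 * m\<^sup>2 + 2 * m = (tri m + 2 * m\<^sup>2 + 2 * m) + int ((n choose 2) + 1 * n)" by blast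
        thus ?thesis using q by (simp only: power_int_add simp_thms power_int_of_nat)
      qed
      have "(x * q powi (tri (int n) + 2 * (int n)\<^sup>2 + 2 * int n)
              + y * q powi (tri (- int 1 - int n) + 2 * (- int 1 - int n)\<^sup>2 + 2 * (- int 1 - int n))) * (1 ^ n * q ^ ((n choose 2) + 1 * n) * (1 / 2))
          = 1 / 2 * (x * q powi (3 * (int n)\<^sup>2 + 2 * int n)) + 1 / 2 * (y * q powi (3 * (- int 1 - int n)\<^sup>2 + 2 * (- int 1 - int n)))" for x y
        unfolding shift[of "int n", symmetric, simplified] shift[of "- int 1 - int n", OF disjI2[OF refl], symmetric]
        by (simp add: distrib_right)
      thus ?thesis unfolding times_divide_eq_right[symmetric] w .
    qed
    have "((\<lambda>n. (-1) powi n * q powi (3 * n\<^sup>2 + 2 * n)) has_sum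
           (qpoch_inf (q ^ 5) (q ^ 6) * qpoch_inf (q ^ (6 - 5)) (q ^ 6) * J 6 q)) UNIV"
    proof (rule jacobi_has_sum_power[OF q])
      show "3 * n\<^sup>2 + 2 * n = int 5 * n + int 6 * tri n" for n
        using two_tri[of n] by (simp add: power2_eq_square algebra_simps)
    qed simp_all
    from has_sum_cmult_right[OF this, of "1 / 2"]
    show "((\<lambda>n. 1 / 2 * ((-1) powi n * q powi (3 * n\<^sup>2 + 2 * n))) has_sum V) UNIV"
      by (simp add: V_def)
  qed simp_all
  also have "qpoch_inf (- 1) q ^ 2 / qpoch_inf q q * V = 2 * (J 2 q * J 6 q ^ 2 / (J 1 q ^ 2 * J 3 q))"
  proof -
    note nz = J_nonzero[OF q(1), of 1] J_nonzero[OF q(1), of 2] J_nonzero[OF q(1), of 3] J_nonzero[OF q(1), of 6]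
    have m1: "qpoch_inf (- 1) q = 2 * (J 2 q / J 1 q)"
      using qpoch_inf_split[OF q(1), of "- 1" 1] qpoch_inf_minus_eq_J[OF q(1)] by (simp add: qpoch_def)
    have "norm (q\<^sup>2) < 1" using q by (simp add: norm_power power_less_one_iff)
    \<comment> \<open>Odd exponents are split by residue 1, 3, 5 modulo 6; this expresses the
      product over residues 1 and 5 through \<open>J\<close>.\<close>
    from qpoch_inf_dissect[OF this, of 3 q]
    have "qpoch_inf q (q\<^sup>2) = qpoch_inf q (q ^ 6) * qpoch_inf (q ^ 3) (q ^ 6) * qpoch_inf (q ^ 5) (q ^ 6)"
      by (simp add: lessThan_Suc numeral_3_eq_3 mult_ac flip: power_mult) (simp add: eval_nat_numeral mult_ac)
    hence "J 1 q / J 2 q = qpoch_inf q (q ^ 6) * (J 3 q / J 6 q) * qpoch_inf (q ^ 5) (q ^ 6)"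
      using qpoch_inf_odd_eq_J[OF q(1), of 1] qpoch_inf_odd_eq_J[OF q(1), of 3] by simp
    hence "qpoch_inf (q ^ 5) (q ^ 6) * qpoch_inf q (q ^ 6) = (J 1 q / J 2 q) * (J 6 q / J 3 q)"
      using nz by (simp add: field_simps)
    moreover have "qpoch_inf q q = J 1 q" by (simp add: J_def)
    ultimately show ?thesis unfolding m1 V_def using nz
      by (simp add: field_simps power2_eq_square)
  qed
  finally show ?thesis .
qed


section \<open>The degenerate case \<open>q = 0\<close>\<close>

lemma qpoch_0_0: "qpoch 0 0 n = 1" "qpoch_inf 0 0 = 1"
  by (simp_all add: qpoch_def qpoch_inf_def)

text \<open>\<open>0 powi e\<close> is 1 for \<open>e = 0\<close> and 0 otherwise, negative
  \<open>e\<close> included, so the series counts the zeros of the exponent.\<close>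

lemma triple_sum_at_0:
  fixes E :: "nat \<Rightarrow> nat \<Rightarrow> nat \<Rightarrow> int"
  assumes "finite S" "\<And>i j k. E i j k = 0 \<longleftrightarrow> (i, j, k) \<in> S"
  shows "((\<lambda>(i, j, k). (0::complex) powi (E i j k) / (qpoch 0 0 i * qpoch 0 0 j * qpoch 0 0 k)) has_sum of_nat (card S)) UNIV"
  by (rule has_sum_finite_neutralI[of S]) (use assms in \<open>auto simp: power_int_0_left_if qpoch_0_0\<close>)

theorem theorem4p13:
  fixes q :: complex
  assumes "norm q < 1"
  shows
   "((\<lambda>(i::nat, j::nat, k::nat).
        q powi (4*int i^2 + 2*int j^2 + int k^2 + 4*int i*int j - 2*int i*int k - 2*int j*int k)
        / (qpoch (q^2) (q^2) i * qpoch (q^2) (q^2) j * qpoch (q^2) (q^2) k))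
      has_sum (J 2 q ^ 3 * Jam 5 12 q / (J 1 q ^ 2 * J 4 q ^ 2))) UNIV \<and>
   ((\<lambda>(i::nat, j::nat, k::nat).
        q powi ((4*int i^2 + 2*int j^2 + int k^2 + 4*int i*int j - 2*int i*int k - 2*int j*int k
                 + int k) div 2)
        / (qpoch q q i * qpoch q q j * qpoch q q k))
      has_sum (J 2 q ^ 2 * J 3 q ^ 2 / (J 1 q ^ 3 * J 6 q))) UNIV \<and>
   ((\<lambda>(i::nat, j::nat, k::nat).
        q powi (4*int i^2 + 2*int j^2 + int k^2 + 4*int i*int j - 2*int i*int k - 2*int j*int k
                + 2*int i)
        / (qpoch (q^2) (q^2) i * qpoch (q^2) (q^2) j * qpoch (q^2) (q^2) k))
      has_sum (J 2 q ^ 3 * Jam 3 12 q / (J 1 q ^ 2 * J 4 q ^ 2))) UNIV \<and>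
   ((\<lambda>(i::nat, j::nat, k::nat).
        q powi ((4*int i^2 + 2*int j^2 + int k^2 + 4*int i*int j - 2*int i*int k - 2*int j*int k
                 + 4*int i + 2*int j - int k) div 2)
        / (qpoch q q i * qpoch q q j * qpoch q q k))
      has_sum (2 * (J 2 q * J 6 q ^ 2 / (J 1 q ^ 2 * J 3 q)))) UNIV \<and>
   ((\<lambda>(i::nat, j::nat, k::nat).
        q powi (4*int i^2 + 2*int j^2 + int k^2 + 4*int i*int j - 2*int i*int k - 2*int j*int k
                + 4*int i + 2*int j)
        / (qpoch (q^2) (q^2) i * qpoch (q^2) (q^2) j * qpoch (q^2) (q^2) k))
      has_sum (J 2 q ^ 3 * Jam 1 12 q / (J 1 q ^ 2 * J 4 q ^ 2))) UNIV"
proof (cases "q = 0")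
  case False
  note q = assms False
  show ?thesis
    using triple_sum_Jam_5_3[OF q, where e = 0 and c = 0 and l = 5] triple_sum_J3[OF q, OF refl]
      triple_sum_Jam_5_3[OF q, where e = 1 and c = "- 1" and l = 3] triple_sum_J6[OF q, OF refl]
      triple_sum_Jam_1[OF q, OF refl]
    by (intro conjI) simp_all
next
  case True
  have J: "J m 0 = 1" if "m > 0" for m
    using that by (simp add: J_def qpoch_0_0 power_0_left)
  have Jam: "Jam l 12 0 = 1" if "0 < l" "l < 12" for l
    using that by (simp add: Jam_def J qpoch_0_0 power_0_left)
  define Q where "Q i j k = 4*int i^2 + 2*int j^2 + int k^2 + 4*int i*int j - 2*int i*int k - 2*int j*int k" for i j k
  \<comment> \<open>As a sum of squares the form vanishes only at the origin.\<close>
  have Q: "Q i j k = (int k - (int i + int j))\<^sup>2 + (int i + int j)\<^sup>2 + 2 * (int i)\<^sup>2" for i j k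
    unfolding Q_def by (simp add: power2_eq_square algebra_simps)
  have E1: "E = 0 \<longleftrightarrow> (i, j, k) \<in> {(0, 0, 0)}" if "E = Q i j k + (a * int i + b * int j)" "a \<ge> 0" "b \<ge> 0" for E i j k a b
  proof
    assume "E = 0"
    hence "(int k - (int i + int j))\<^sup>2 + (int i + int j)\<^sup>2 + 2 * (int i)\<^sup>2 + (a * int i + b * int j) = 0"
      using that(1) unfolding Q by simp
    moreover have "(int k - (int i + int j))\<^sup>2 \<ge> 0" "(int i + int j)\<^sup>2 \<ge> 0" "(int i)\<^sup>2 \<ge> 0" "a * int i + b * int j \<ge> 0"
      using that by simp_all
    ultimately have "(int k - (int i + int j))\<^sup>2 = 0" "(int i + int j)\<^sup>2 = 0" by linarith+
    thus "(i, j, k) \<in> {(0, 0, 0)}" by simp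
  qed (use that in \<open>simp add: Q\<close>)
  have le: "x \<le> x\<^sup>2" "- x \<le> x\<^sup>2" for x :: int
    using abs_le_power2_int[of x] by linarith+
  have E2: "(Q i j k + int k) div 2 = 0 \<longleftrightarrow> (i, j, k) \<in> {(0, 0, 0)}" for i j k
  proof
    assume "(Q i j k + int k) div 2 = 0"
    hence "(int k - (int i + int j))\<^sup>2 + (int i + int j)\<^sup>2 + 2 * (int i)\<^sup>2 + int k < 2"
      unfolding Q by linarith
    moreover have "(int i)\<^sup>2 \<ge> 0" by simp
    ultimately have "int i + int j < 1" "int k < 1"
      using le[of "int i + int j"] le[of "int k - (int i + int j)"] by linarith+
    thus "(i, j, k) \<in> {(0, 0, 0)}" by simp
  qed (simp add: Q)
  \<comment> \<open>The additional zero \<open>(0, 0, 1)\<close>, where \<open>k^2 - k = 0\<close>,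
    matches the factor 2 on the right of the fourth identity.\<close>
  have E4: "(Q i j k + 4*int i + 2*int j - int k) div 2 = 0 \<longleftrightarrow> (i, j, k) \<in> {(0, 0, 0), (0, 0, 1)}" for i j k
  proof
    assume "(Q i j k + 4*int i + 2*int j - int k) div 2 = 0"
    hence *: "(int k - (int i + int j))\<^sup>2 + (int i + int j)\<^sup>2 + 2 * (int i)\<^sup>2 + 4*int i + 2*int j - int k < 2"
      unfolding Q by linarith
    hence "int i + int j < 1"
      using le[of "int i + int j"] le[of "int k - (int i + int j)"] zero_le_power2[of "int i"] by linarith
    hence 0: "i = 0" "j = 0" by simp_all
    have "0 \<le> (int k - 2) * (int k - 2)" by simp
    hence "int k < 2" using * 0 by (simp add: power2_eq_square algebra_simps)
    hence "k = 0 \<or> k = 1" by auto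
    thus "(i, j, k) \<in> {(0, 0, 0), (0, 0, 1)}" using 0 by auto
  qed (auto simp: Q)
  note sums = triple_sum_at_0[of "{(0, 0, 0)}"] triple_sum_at_0[of "{(0, 0, 0), (0, 0, 1)}"]
  have "((\<lambda>(i, j, k). 0 powi (Q i j k) / (qpoch 0 0 i * qpoch 0 0 j * qpoch 0 0 k)) has_sum of_nat (card {(0::nat, 0::nat, 0::nat)})) UNIV"
    by (rule sums(1)) (use E1[of _ _ _ _ 0 0] in auto)
  moreover have "((\<lambda>(i, j, k). 0 powi ((Q i j k + int k) div 2) / (qpoch 0 0 i * qpoch 0 0 j * qpoch 0 0 k)) has_sum of_nat (card {(0::nat, 0::nat, 0::nat)})) UNIV"
    by (rule sums(1)) (use E2 in auto)
  moreover have "((\<lambda>(i, j, k). 0 powi (Q i j k + 2 * int i) / (qpoch 0 0 i * qpoch 0 0 j * qpoch 0 0 k)) has_sum of_nat (card {(0::nat, 0::nat, 0::nat)})) UNIV"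
    by (rule sums(1)) (use E1[of _ _ _ _ 2 0] in auto)
  moreover have "((\<lambda>(i, j, k). 0 powi ((Q i j k + 4*int i + 2*int j - int k) div 2) / (qpoch 0 0 i * qpoch 0 0 j * qpoch 0 0 k)) has_sum of_nat (card {(0::nat, 0::nat, 0::nat), (0, 0, 1)})) UNIV"
    by (rule sums(2)) (use E4 in auto)
  moreover have "((\<lambda>(i, j, k). 0 powi (Q i j k + 4*int i + 2*int j) / (qpoch 0 0 i * qpoch 0 0 j * qpoch 0 0 k)) has_sum of_nat (card {(0::nat, 0::nat, 0::nat)})) UNIV"
    by (rule sums(1)) (use E1[of _ _ _ _ 4 2] in \<open>auto simp: add.assoc\<close>)
  ultimately show ?thesis unfolding True Q_def by (simp add: J Jam)
qed

end
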